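(* Let $\underline{\mathbb N}=\{\underline n:n\in\mathbb N\}$ be a copy of the set $\mathbb N$ (with $n\mapsto\underline n$ a bijection), let $F(\underline{\mathbb N})$ be the free group on the alphabet $\underline{\mathbb N}$ with the discrete topology, and let $G=F(\underline{\mathbb N})^{\mathbb N}$ carry the Tychonoff product topology. For $z\in\mathbb Z^{\mathbb N}$ define $g_z\in G$ by $g_z(i)=\underline 0^{z(0)}\,\underline 1^{z(1)}\cdots\underline i^{z(i)}$ for $i\in\mathbb N$ (product in $F(\underline{\mathbb N})$). Let $H$ be the subgroup of $G$ generated by $\{g_z:z\in\mathbb Z^{\mathbb N}\}$, equipped with the subspace topology. Then: (i) $H$ is a separable metric group; (ii) $H$ has a linear topology; and there is a sequence $B=\{b_n:n\in\mathbb N\}$ of elements of $H$ such that (iii) $B$ is an $f_\omega$-productive sequence in $H$; (iv) there exists a bijection $\varphi:\mathbb N\to\mathbb N$ such that the sequence $\{b_{\varphi(n)}:n\in\mathbb N\}$ is not productive in $H$. Moreover, (v) $H$ does not contain any unconditionally $f_\omega$-productive sequence; that is, $H$ is TAP.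
   Context: All topological groups are Hausdorff; $\mathbb N=\{0,1,2,\dots\}$. A metric group is a metrizable topological group. A topological group has a linear topology if it has a base of neighbourhoods of the identity formed by open subgroups. Products are ordered: $\prod_{n=0}^m b_n=b_0b_1\cdots b_m$. A sequence $\{b_n:n\in\mathbb N\}$ in a topological group $G$ is productive in $G$ if the sequence $\{\prod_{n=0}^m b_n:m\in\mathbb N\}$ converges to some element of $G$. A sequence $\{a_n:n\in\mathbb N\}$ in $G$ is $f_\omega$-productive in $G$ if it is faithfully indexed ($a_n\neq a_m$ for $n\ne m$) and $\{a_n^{z(n)}:n\in\mathbb N\}$ is productive in $G$ for every function $z:\mathbb N\to\mathbb Z$. (Here $f_\omega$ is the constant function on $\mathbb N$ with value the first infinite ordinal $\omega$.) It is unconditionally $f_\omega$-productive in $G$ if it is faithfully indexed and $\{a_{\varphi(n)}:n\in\mathbb N\}$ is $f_\omega$-productive in $G$ for every bijection $\varphi:\mathbb N\to\mathbb N$. A topological group is TAP if it contains no unconditionally $f_\omega$-productive sequence. *)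

theory Defs
  imports "HOL-Analysis.Analysis" "HOL-Algebra.Product_Groups"
begin

section \<open>Topological groups\<close>

text \<open>Topological groups are Hausdorff by convention.\<close>

locale topological_group = group G for G (structure) +
  fixes T :: "'a topology"
  assumes topspace_eq: "topspace T = carrier G"
    and continuous_mult: "continuous_map (prod_topology T T) T (\<lambda>(x, y). x \<otimes> y)"
    and continuous_inv: "continuous_map T T (\<lambda>x. inv x)"
    and Hausdorff: "Hausdorff_space T"

definition metric_group :: "('a, 'b) monoid_scheme \<Rightarrow> 'a topology \<Rightarrow> bool" where
  "metric_group G T \<longleftrightarrow> topological_group G T \<and> metrizable_space T"

definition linear_topology :: "('a, 'b) monoid_scheme \<Rightarrow> 'a topology \<Rightarrow> bool" where
  "linear_topology G T \<longleftrightarrow> topological_group G T \<and>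
     (\<exists>\<B>. (\<forall>V\<in>\<B>. subgroup V G \<and> openin T V) \<and>
          (\<forall>U. openin T U \<and> \<one>\<^bsub>G\<^esub> \<in> U \<longrightarrow> (\<exists>V\<in>\<B>. V \<subseteq> U)))"


section \<open>Productive sequences\<close>

text \<open>\<open>ordered_prod G b m\<close> is the product \<open>b 0 \<otimes> b 1 \<otimes> \<dots> \<otimes> b m\<close> of \<open>m + 1\<close> factors, in this order.\<close>

primrec ordered_prod :: "('a, 'b) monoid_scheme \<Rightarrow> (nat \<Rightarrow> 'a) \<Rightarrow> nat \<Rightarrow> 'a" where
  "ordered_prod G b 0 = b 0"
| "ordered_prod G b (Suc m) = ordered_prod G b m \<otimes>\<^bsub>G\<^esub> b (Suc m)"

definition productive :: "('a, 'b) monoid_scheme \<Rightarrow> 'a topology \<Rightarrow> (nat \<Rightarrow> 'a) \<Rightarrow> bool" where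
  "productive G T b \<longleftrightarrow> range b \<subseteq> carrier G \<and> (\<exists>x. limitin T (ordered_prod G b) x sequentially)"

definition f_omega_productive :: "('a, 'b) monoid_scheme \<Rightarrow> 'a topology \<Rightarrow> (nat \<Rightarrow> 'a) \<Rightarrow> bool" where
  "f_omega_productive G T a \<longleftrightarrow> range a \<subseteq> carrier G \<and> inj a \<and>
     (\<forall>z :: nat \<Rightarrow> int. productive G T (\<lambda>n. a n [^]\<^bsub>G\<^esub> z n))"

definition unconditionally_f_omega_productive ::
    "('a, 'b) monoid_scheme \<Rightarrow> 'a topology \<Rightarrow> (nat \<Rightarrow> 'a) \<Rightarrow> bool" where
  "unconditionally_f_omega_productive G T a \<longleftrightarrow> range a \<subseteq> carrier G \<and> inj a \<and>
     (\<forall>\<phi> :: nat \<Rightarrow> nat. bij \<phi> \<longrightarrow> f_omega_productive G T (\<lambda>n. a (\<phi> n)))"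

definition TAP :: "('a, 'b) monoid_scheme \<Rightarrow> 'a topology \<Rightarrow> bool" where
  "TAP G T \<longleftrightarrow> topological_group G T \<and> \<not> (\<exists>a. unconditionally_f_omega_productive G T a)"


section \<open>Free groups\<close>

text \<open>
  The free group on an alphabet \<open>A\<close> is realised as the set of reduced words over \<open>A\<close>.  The pair
  \<open>(a, True)\<close> stands for the letter \<open>a\<close> and \<open>(a, False)\<close> for its formal inverse.
\<close>

type_synonym 'a letters = "('a \<times> bool) list"

definition inv_letter :: "'a \<times> bool \<Rightarrow> 'a \<times> bool" where
  "inv_letter l = (fst l, \<not> snd l)"

definition freely_reduced :: "'a letters \<Rightarrow> bool" where
  "freely_reduced w \<longleftrightarrow> successively (\<lambda>l l'. l' \<noteq> inv_letter l) w"

fun push_letter :: "'a \<times> bool \<Rightarrow> 'a letters \<Rightarrow> 'a letters" where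
  "push_letter l [] = [l]"
| "push_letter l (l' # w) = (if l' = inv_letter l then w else l # l' # w)"

text \<open>On reduced words, \<open>foldr push_letter u v\<close> is the reduced form of the concatenation \<open>u @ v\<close>.\<close>

definition free_group :: "'a set \<Rightarrow> 'a letters monoid" where
  "free_group A =
     \<lparr>carrier = {w. freely_reduced w \<and> fst ` set w \<subseteq> A},
      monoid.mult = (\<lambda>u v. foldr push_letter u v),
      one = []\<rparr>"

definition free_gen :: "'a \<Rightarrow> 'a letters" where
  "free_gen a = [(a, True)]"

lemma inv_letter_simps [simp]:
  "inv_letter (inv_letter l) = l" "fst (inv_letter l) = fst l" "inv_letter l \<noteq> l" "l \<noteq> inv_letter l"
  by (auto simp: inv_letter_def prod_eq_iff)

lemma reduced_simps [simp]:
  "freely_reduced []" "freely_reduced [l]"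
  "freely_reduced (l # l' # w) \<longleftrightarrow> l' \<noteq> inv_letter l \<and> freely_reduced (l' # w)"
  by (auto simp: freely_reduced_def)

lemma reduced_tl: "freely_reduced (l # w) \<Longrightarrow> freely_reduced w"
  by (cases w) auto

lemma reduced_push: "freely_reduced w \<Longrightarrow> freely_reduced (push_letter l w)"
  by (cases w) (auto dest: reduced_tl)

lemma push_reduced: "freely_reduced (l # w) \<Longrightarrow> push_letter l w = l # w"
  by (cases w) auto

lemma push_push_inv: "freely_reduced w \<Longrightarrow> push_letter l (push_letter (inv_letter l) w) = w"
  by (cases w) (auto simp: push_reduced)

lemma reduced_mult: "freely_reduced v \<Longrightarrow> freely_reduced (foldr push_letter u v)"
  by (induction u) (auto simp: reduced_push)

lemma letters_mult: "fst ` set (foldr push_letter u v) \<subseteq> fst ` set u \<union> fst ` set v"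
proof -
  have push: "fst ` set (push_letter l w) \<subseteq> insert (fst l) (fst ` set w)" for l :: "'a \<times> bool" and w
    by (cases w) auto
  show ?thesis
  proof (induction u)
    case (Cons l u)
    have "fst ` set (foldr push_letter (l # u) v) \<subseteq> insert (fst l) (fst ` set (foldr push_letter u v))"
      using push[of l "foldr push_letter u v"] by simp
    also have "\<dots> \<subseteq> insert (fst l) (fst ` set u \<union> fst ` set v)"
      using Cons.IH by (rule insert_mono)
    finally show ?case by simp
  qed simp
qed

lemma mult_push:
  assumes "freely_reduced w"
  shows "foldr push_letter (push_letter l u) w = push_letter l (foldr push_letter u w)"
proof (cases u)
  case (Cons l' u')
  then show ?thesis
    using push_push_inv[OF reduced_mult[OF assms]] by auto
qed simp

lemma word_mult_assoc:
  assumes "freely_reduced w"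
  shows "foldr push_letter (foldr push_letter u v) w = foldr push_letter u (foldr push_letter v w)"
  by (induction u) (simp_all add: mult_push assms)

lemma mult_inv_word: "foldr push_letter (rev (map inv_letter u)) u = []"
  by (induction u) auto

lemma group_free_group: "group (free_group A)"
proof (rule groupI)
  fix x assume x: "x \<in> carrier (free_group A)"
  let ?y = "foldr push_letter (rev (map inv_letter x)) []"
  have "fst ` set ?y \<subseteq> fst ` set x"
    using letters_mult[of "rev (map inv_letter x)" "[]"] by force
  then have "?y \<in> carrier (free_group A)"
    using x by (auto simp: free_group_def reduced_mult)
  moreover have "?y \<otimes>\<^bsub>free_group A\<^esub> x = \<one>\<^bsub>free_group A\<^esub>"
    using x by (simp add: free_group_def word_mult_assoc mult_inv_word)
  ultimately show "\<exists>y\<in>carrier (free_group A). y \<otimes>\<^bsub>free_group A\<^esub> x = \<one>\<^bsub>free_group A\<^esub>"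
    by blast
next
  fix x y assume "x \<in> carrier (free_group A)" "y \<in> carrier (free_group A)"
  then have "freely_reduced y" "fst ` set x \<union> fst ` set y \<subseteq> A"
    by (auto simp: free_group_def)
  then show "x \<otimes>\<^bsub>free_group A\<^esub> y \<in> carrier (free_group A)"
    using order_trans[OF letters_mult[of x y]] by (simp add: free_group_def reduced_mult)
qed (auto simp: free_group_def word_mult_assoc)


section \<open>The group \<open>H\<close>\<close>

text \<open>
  \<open>N\<close> is the alphabet and \<open>ul\<close> is the enumeration of \<open>N\<close> by the natural numbers.
\<close>

definition G_group :: "'a set \<Rightarrow> (nat \<Rightarrow> 'a letters) monoid" where
  "G_group N = product_group UNIV (\<lambda>i. free_group N)"

definition G_topology :: "'a set \<Rightarrow> (nat \<Rightarrow> 'a letters) topology" where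
  "G_topology N = product_topology (\<lambda>i. discrete_topology (carrier (free_group N))) UNIV"

definition g_elem :: "'a set \<Rightarrow> (nat \<Rightarrow> 'a) \<Rightarrow> (nat \<Rightarrow> int) \<Rightarrow> nat \<Rightarrow> 'a letters" where
  "g_elem N ul z =
     (\<lambda>i. ordered_prod (free_group N) (\<lambda>n. free_gen (ul n) [^]\<^bsub>free_group N\<^esub> z n) i)"

definition H_group :: "'a set \<Rightarrow> (nat \<Rightarrow> 'a) \<Rightarrow> (nat \<Rightarrow> 'a letters) monoid" where
  "H_group N ul = subgroup_generated (G_group N) (range (g_elem N ul))"

definition H_topology :: "'a set \<Rightarrow> (nat \<Rightarrow> 'a) \<Rightarrow> (nat \<Rightarrow> 'a letters) topology" where
  "H_topology N ul = subtopology (G_topology N) (carrier (H_group N ul))"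

text \<open>
  \<^const>\<open>subgroup_generated\<close> intersects the generating set with the carrier; here this removes nothing.
\<close>

lemma g_elem_in_carrier:
  assumes "range ul \<subseteq> N"
  shows "g_elem N ul z \<in> carrier (G_group N)"
proof -
  interpret group "free_group N" by (rule group_free_group)
  have "free_gen (ul n) \<in> carrier (free_group N)" for n
    using assms by (auto simp: free_group_def free_gen_def)
  then have "g_elem N ul z i \<in> carrier (free_group N)" for i
    unfolding g_elem_def by (induction i) auto
  then show ?thesis
    by (auto simp: G_group_def)
qed

end

theory Submission
  imports Defs "HOL-Library.Sublist"
begin

text \<open>
  The coordinates of a product of \<open>k\<close> elements \<open>g\<^sub>z\<close> or their inverses are words that split into at most
  \<open>k\<close> blocks in which the indices of the letters are monotone, because reduction only passes to a
  subsequence.  Hence the number of monotone blocks of the coordinates of an element of \<open>H\<close> is bounded.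
  The product of the basis elements in the order \<open>1, 0, 3, 2, \<dots>\<close> violates this.

  For an unconditionally \<open>f\<^sub>\<omega>\<close>-productive sequence \<open>a\<close>, a Baire category argument bounds the number of
  blocks uniformly over all finite products of powers of distinct members of a tail of \<open>a\<close>, in any order.
  Applied to the powers of one \<open>a n\<close>, this makes every coordinate \<open>a n j\<close> a conjugate of a power of a
  single letter, which is determined by the first nontrivial coordinate of \<open>a n\<close>.  For suitable large
  exponents these letters survive in a finite product, so that a zigzag order of
  the factors contradicts the uniform bound.
\<close>


section \<open>Monotone blocks\<close>

primrec mono_blocks :: "nat \<Rightarrow> 'b::linorder list \<Rightarrow> bool" where
  "mono_blocks 0 xs \<longleftrightarrow> xs = []"
| "mono_blocks (Suc k) xs \<longleftrightarrow> (\<exists>u v. xs = u @ v \<and> (sorted u \<or> sorted (rev u)) \<and> mono_blocks k v)"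

lemma sorted_subseq: "subseq xs ys \<Longrightarrow> sorted ys \<Longrightarrow> sorted xs"
  by (metis sorted_nths subseq_conv_nths)

lemma sorted_rev_subseq: "subseq xs ys \<Longrightarrow> sorted (rev ys) \<Longrightarrow> sorted (rev xs)"
proof (induction rule: list_emb.induct)
  case (list_emb_Cons2 x y xs ys)
  then show ?case
    by (auto simp: sorted_append dest: set_nths_subset[THEN subsetD] simp: subseq_conv_nths)
qed (auto simp: sorted_append)

lemma blocks_Nil [simp]: "mono_blocks k []"
  by (induction k) auto

text \<open>A subsequence meets each block in a subsequence of that block, which is again monotone.
  Free reduction only deletes letters, so bounds pass from concatenations to reduced forms.\<close>

lemma blocks_subseq: "mono_blocks k ys \<Longrightarrow> subseq xs ys \<Longrightarrow> mono_blocks k xs"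
proof (induction k arbitrary: xs ys)
  case (Suc k)
  then obtain u v where uv: "ys = u @ v" "sorted u \<or> sorted (rev u)" "mono_blocks k v" by auto
  with Suc.prems obtain u' v' where "xs = u' @ v'" "subseq u' u" "subseq v' v"
    by (metis subseq_appendE)
  then show ?case using uv Suc.IH
    by (metis mono_blocks.simps(2) sorted_rev_subseq sorted_subseq)
qed simp

lemma blocks_append: "mono_blocks j xs \<Longrightarrow> mono_blocks k ys \<Longrightarrow> mono_blocks (j + k) (xs @ ys)"
proof (induction j arbitrary: xs)
  case (Suc j)
  then show ?case by simp (metis append.assoc)
qed simp

lemma blocks_1: "sorted xs \<Longrightarrow> mono_blocks 1 xs"
  by auto

lemma blocks_rev: "mono_blocks k xs \<Longrightarrow> mono_blocks k (rev xs)"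
proof (induction k arbitrary: xs)
  case (Suc k)
  then obtain u v where uv: "xs = u @ v" "sorted u \<or> sorted (rev u)" "mono_blocks k v" by auto
  then have "mono_blocks 1 (rev u)" by auto
  with uv Suc.IH show ?case using blocks_append[of k "rev v" 1 "rev u"] by simp
qed simp

section \<open>Zigzag lists, which need many blocks\<close>

fun zigzag :: "'b::linorder list \<Rightarrow> bool" where
  "zigzag (x # y # z # xs) \<longleftrightarrow> (x < y \<and> z < y \<or> y < x \<and> y < z) \<and> zigzag (y # z # xs)"
| "zigzag _ \<longleftrightarrow> True"

lemma zigzag_Cons: "zigzag (x # xs) \<Longrightarrow> zigzag xs"
  by (cases "x # xs" rule: zigzag.cases) auto

lemma zigzag_append: "zigzag (xs @ ys) \<Longrightarrow> zigzag ys"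
  by (induction xs) (auto dest: zigzag_Cons)

text \<open>Three consecutive entries of a zigzag list change direction, so no block contains more
  than two entries.\<close>

lemma zigzag_blocks: "zigzag xs \<Longrightarrow> mono_blocks k xs \<Longrightarrow> length xs \<le> 2 * k"
proof (induction k arbitrary: xs)
  case (Suc k)
  then obtain u v where uv: "xs = u @ v" "sorted u \<or> sorted (rev u)" "mono_blocks k v" by auto
  have "length u \<le> 2"
  proof (cases u rule: zigzag.cases)
    case (1 x y z us)
    then show ?thesis using uv Suc.prems by (auto simp: sorted_append)
  qed auto
  moreover have "length v \<le> 2 * k"
    using Suc zigzag_append uv by blast
  ultimately show ?case using uv by simp
qed simp

lemma zigzag_conv_nth:
  "zigzag xs \<longleftrightarrow> (\<forall>i. Suc (Suc i) < length xs \<longrightarrow>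
     xs ! i < xs ! Suc i \<and> xs ! Suc (Suc i) < xs ! Suc i \<or>
     xs ! Suc i < xs ! i \<and> xs ! Suc i < xs ! Suc (Suc i))"
proof (induction xs rule: zigzag.induct)
  case (1 x y z xs)
  have all_nat: "(\<forall>i. P i) \<longleftrightarrow> P 0 \<and> (\<forall>i. P (Suc i))" for P
    by (metis not0_implies_Suc)
  show ?case
    by (subst zigzag.simps(1), subst 1, subst (2) all_nat) simp
qed auto

text \<open>The involution with values 1, 0, 3, 2, ...; the subtraction occurs only for odd
  \<open>n\<close> and never truncates.\<close>

definition swap_adjacent :: "nat \<Rightarrow> nat" where
  "swap_adjacent n = (if even n then Suc n else n - 1)"

lemma swap_swap [simp]: "swap_adjacent (swap_adjacent n) = n"
  by (auto simp: swap_adjacent_def elim: oddE)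

lemma bij_swap: "bij swap_adjacent"
  using swap_swap by (metis bij_betw_def inj_def surjI)

text \<open>Each pair of an even number and its successor is kept, so initial segments of even
  length are permuted. Cutoffs are therefore taken even later on.\<close>

lemma swap_less: "n < 2 * m \<longleftrightarrow> swap_adjacent n < 2 * m"
proof -
  have "n < 2 * m \<Longrightarrow> swap_adjacent n < 2 * m" for n
    by (cases "even n") (auto simp: swap_adjacent_def elim!: evenE)
  then show ?thesis by (metis swap_swap)
qed

lemma zigzag_swap:
  fixes f :: "nat \<Rightarrow> 'b::linorder"
  assumes "strict_mono f" shows "zigzag (map (\<lambda>i. f (swap_adjacent i)) [0..<n])"
  unfolding zigzag_conv_nth
  using assms by (auto simp: swap_adjacent_def strict_mono_less elim!: oddE)

lemma zigzag_alternating: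
  fixes p q :: "'b::linorder"
  assumes "p \<noteq> q" shows "zigzag (concat (replicate n [p, q]))"
proof -
  \<comment> \<open>The second conjunct strengthens the induction: removing one leading
    \<open>p\<close> leaves a list that starts with \<open>q\<close>.\<close>
  have "zigzag ((concat (replicate n [p, q]))) \<and> zigzag (q # concat (replicate n [p, q]))"
  proof (induction n)
    case (Suc n)
    then show ?case using assms by (cases n) auto
  qed simp
  then show ?thesis ..
qed

lemma subseq_pair:
  assumes "x \<in> set v" "y \<in> set v" "x \<noteq> y"
  shows "subseq [x, y] v \<or> subseq [y, x] v"
  using assms
proof (induction v)
  case (Cons a v)
  then show ?case by (auto simp: subseq_singleton_left)
qed simp

lemma subseq_concat_replicate: "subseq u v \<Longrightarrow> subseq (concat (replicate n u)) (concat (replicate n v))"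
  by (induction n) (auto intro: list_emb_append_mono)

text \<open>Two distinct entries of \<open>v\<close> would give the repeated list an alternating
  subsequence of length \<open>2 * Suc k\<close>, too long for \<open>k\<close> blocks.\<close>

lemma blocks_concat_replicate:
  assumes "mono_blocks k (concat (replicate (Suc k) v))" "p \<in> set v" "q \<in> set v"
  shows "p = q"
proof (rule ccontr)
  assume "p \<noteq> q"
  have False if "subseq [a, b] v" "a \<noteq> b" for a b
  proof -
    have "mono_blocks k (concat (replicate (Suc k) [a, b]))"
      using assms(1) subseq_concat_replicate[OF that(1)] by (rule blocks_subseq)
    then have "length (concat (replicate (Suc k) [a, b])) \<le> 2 * k"
      by (rule zigzag_blocks[OF zigzag_alternating[OF that(2)]])
    then show False by (simp add: length_concat sum_list_replicate)
  qed
  then show False using subseq_pair[OF assms(2,3)] \<open>p \<noteq> q\<close> by metis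
qed


section \<open>Reduced words\<close>

abbreviation formal_inv :: "'a letters \<Rightarrow> 'a letters" where
  "formal_inv u \<equiv> rev (map inv_letter u)"

lemma subseq_push: "subseq (push_letter l w) (l # w)"
  by (cases w) auto

text \<open>Every push either adds its letter in front or deletes a letter, so nothing is ever
  reordered.\<close>

lemma subseq_mult: "subseq (foldr push_letter u v) (u @ v)"
proof (induction u)
  case (Cons l u)
  then have "subseq (l # foldr push_letter u v) (l # u @ v)" by simp
  then show ?case
    using subseq_push[of l "foldr push_letter u v"]
    by (metis append_Cons foldr_Cons o_apply subseq_order.trans)
qed simp

lemma reduced_append:
  "freely_reduced (u @ v) \<longleftrightarrow>
     freely_reduced u \<and> freely_reduced v \<and> (u = [] \<or> v = [] \<or> hd v \<noteq> inv_letter (last u))"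
  by (auto simp: freely_reduced_def successively_append_iff)

lemma mult_reduced: "freely_reduced (u @ v) \<Longrightarrow> foldr push_letter u v = u @ v"
proof (induction u)
  case (Cons l u)
  then show ?case using reduced_tl by (fastforce simp: push_reduced)
qed simp

lemma mult_Nil_right: "freely_reduced u \<Longrightarrow> foldr push_letter u [] = u"
  using mult_reduced[of u "[]"] by simp

lemma reduced_formal_inv: "freely_reduced w \<Longrightarrow> freely_reduced (formal_inv w)"
  unfolding freely_reduced_def
  by (simp add: successively_map) (metis (mono_tags, lifting) inv_letter_simps(1) successively_mono)

lemma mult_formal_inv_cancel: "foldr push_letter (formal_inv u) (u @ x) = x"
  by (induction u) auto

lemma mult_formal_inv_left:
  "freely_reduced x \<Longrightarrow> foldr push_letter (formal_inv u) (foldr push_letter u x) = x"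
  by (simp add: word_mult_assoc[symmetric] mult_inv_word)

lemma mult_formal_inv_right:
  "freely_reduced x \<Longrightarrow> foldr push_letter u (foldr push_letter (formal_inv u) x) = x"
  using mult_formal_inv_left[of x "formal_inv u"] by (simp add: rev_map o_def)

lemma mult_formal_inv_Nil: "foldr push_letter u (formal_inv u) = []"
  using mult_inv_word[of "formal_inv u"] by (simp add: rev_map o_def)

section \<open>Cyclic reduction and powers of conjugates\<close>

text \<open>Mutually inverse outer letters are stripped until the ends of the core \<open>v\<close>
  no longer cancel; then consecutive copies of \<open>v\<close> in a power do not interact.\<close>

lemma cyclic_reduction:
  assumes "freely_reduced w" "w \<noteq> []"
  shows "\<exists>c v. w = c @ v @ formal_inv c \<and> v \<noteq> [] \<and> hd v \<noteq> inv_letter (last v)"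
  using assms
proof (induction "length w" arbitrary: w rule: less_induct)
  case less
  show ?case
  proof (cases "hd w = inv_letter (last w)")
    case False
    then show ?thesis using less.prems by (intro exI[of _ "[]"] exI[of _ w]) simp
  next
    case True
    obtain l w1 where w1: "w = l # w1" using less.prems(2) by (cases w) auto
    with True have "w1 \<noteq> []" by auto
    then obtain w2 l' where w2: "w1 = w2 @ [l']" by (metis rev_exhaust)
    have l': "l' = inv_letter l" using True w1 w2 by simp
    \<comment> \<open>An empty \<open>w2\<close> would make \<open>w\<close> the word
      \<open>[l, inv_letter l]\<close>, which is not reduced.\<close>
    have "w2 \<noteq> []" "freely_reduced w2"
      using less.prems(1) w1 w2 l' reduced_append[of "[l] @ w2" "[l']"] reduced_append[of "[l]" w2] by auto
    then obtain c v where "w2 = c @ v @ formal_inv c" "v \<noteq> []" "hd v \<noteq> inv_letter (last v)"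
      using less.hyps[of w2] w1 w2 by auto
    then show ?thesis using w1 w2 l' by (intro exI[of _ "l # c"] exI[of _ v]) simp
  qed
qed

lemma reduced_concat_replicate:
  assumes "freely_reduced v" "v \<noteq> []" "hd v \<noteq> inv_letter (last v)"
  shows "freely_reduced (concat (replicate n v))"
proof (induction n)
  case (Suc n)
  then show ?case using assms by (cases n) (auto simp: reduced_append)
qed simp

lemma last_concat_replicate: "v \<noteq> [] \<Longrightarrow> last (concat (replicate (Suc n) v)) = last v"
  by (induction n) auto

lemma concat_replicate_Suc: "concat (replicate (Suc n) v) = concat (replicate n v) @ v"
  by (induction n) auto

lemma reduced_replace_middle:
  assumes "freely_reduced (u @ v @ w)" "freely_reduced v'" "v \<noteq> []" "v' \<noteq> []"
    "hd v' = hd v" "last v' = last v"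
  shows "freely_reduced (u @ v' @ w)"
  using assms by (simp add: reduced_append)

text \<open>The repeated core starts and ends with the same letters as \<open>v\<close>, so no
  cancellation arises at its borders with the conjugating word.\<close>

lemma reduced_conjugate_power:
  assumes "freely_reduced (c @ v @ formal_inv c)" "v \<noteq> []" "hd v \<noteq> inv_letter (last v)"
  shows "freely_reduced (c @ concat (replicate (Suc n) v) @ formal_inv c)"
proof (rule reduced_replace_middle[OF assms(1)])
  show "freely_reduced (concat (replicate (Suc n) v))"
    using assms by (intro reduced_concat_replicate) (auto simp: reduced_append)
  show "last (concat (replicate (Suc n) v)) = last v"
    using assms(2) by (rule last_concat_replicate)
qed (use assms(2) in auto)

text \<open>The inner \<open>formal_inv c\<close> and \<open>c\<close> cancel and the rest is
  already reduced. The exponent starts at 1: for exponent 0 the right-hand side would be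
  \<open>c @ formal_inv c\<close>, which is not reduced unless \<open>c\<close> is empty.\<close>

lemma power_conjugate:
  assumes "freely_reduced (c @ v @ formal_inv c)" "v \<noteq> []" "hd v \<noteq> inv_letter (last v)"
  shows "(c @ v @ formal_inv c) [^]\<^bsub>free_group A\<^esub> Suc n = c @ concat (replicate (Suc n) v) @ formal_inv c"
proof (induction n)
  case 0
  then show ?case using assms by (simp add: free_group_def nat_pow_def mult_Nil_right)
next
  case (Suc n)
  let ?V = "concat (replicate (Suc n) v)"
  have "(c @ v @ formal_inv c) [^]\<^bsub>free_group A\<^esub> Suc (Suc n)
      = (c @ v @ formal_inv c) [^]\<^bsub>free_group A\<^esub> (Suc n) \<otimes>\<^bsub>free_group A\<^esub> (c @ v @ formal_inv c)"
    by (simp only: nat_pow_Suc)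
  also have "\<dots> = foldr push_letter (c @ ?V @ formal_inv c) (c @ v @ formal_inv c)"
    by (simp only: Suc) (simp add: free_group_def)
  also have "\<dots> = foldr push_letter (c @ ?V) (v @ formal_inv c)"
    by (simp add: mult_formal_inv_cancel)
  also have "\<dots> = (c @ ?V) @ v @ formal_inv c"
  proof (rule mult_reduced)
    have "concat (replicate (Suc (Suc n)) v) = ?V @ v"
      by (rule concat_replicate_Suc)
    then show "freely_reduced ((c @ ?V) @ v @ formal_inv c)"
      using reduced_conjugate_power[OF assms, of "Suc n"] by (simp only: append_assoc)
  qed
  also have "\<dots> = c @ concat (replicate (Suc (Suc n)) v) @ formal_inv c"
    by (simp only: concat_replicate_Suc[of "Suc n"] append_assoc)
  finally show ?case .
qed

text \<open>With one letter name only a letter and its inverse are available, and these cannot be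
  neighbours in a reduced word.\<close>

lemma reduced_single_letter:
  assumes "freely_reduced v" "\<And>l l'. l \<in> set v \<Longrightarrow> l' \<in> set v \<Longrightarrow> fst l = fst l'"
  shows "\<exists>y. v = replicate (length v) y"
  using assms
proof (induction v)
  case (Cons l v)
  then obtain y where y: "v = replicate (length v) y"
    using reduced_tl by (metis list.set_intros(2))
  show ?case
  proof (cases v)
    case (Cons l' v')
    then have "l' \<noteq> inv_letter l" "fst l' = fst l" using Cons.prems by auto
    then have "l' = l" by (auto simp: inv_letter_def prod_eq_iff)
    then show ?thesis using Cons y by (metis length_Cons list.inject replicate_Suc)
  qed (auto intro: exI[of _ l])
qed simp

section \<open>Large powers do not cancel\<close>

text \<open>Each pushed letter deletes at most one letter, so \<open>x\<close> absorbs all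
  cancellation and \<open>s\<close> survives.\<close>

lemma mult_append_long:
  assumes "length u \<le> length x"
  shows "\<exists>x'. foldr push_letter u (x @ s) = x' @ s \<and> length x \<le> length u + length x'"
  using assms
proof (induction u)
  case (Cons l u)
  then obtain x' where x': "foldr push_letter u (x @ s) = x' @ s" "length x \<le> length u + length x'"
    by auto
  then have "x' \<noteq> []" using Cons.prems by auto
  then obtain l' x'' where "x' = l' # x''" by (cases x') auto
  then show ?case using x' by auto
qed auto

text \<open>The letter \<open>y'\<close> is a barrier: copies of \<open>y\<close> can cancel only
  against letters of \<open>x\<close>.\<close>

lemma mult_replicate:
  assumes "fst y \<noteq> fst y'"
  shows "\<exists>r x'. foldr push_letter (replicate e y) (x @ y' # s) = replicate (e - r) y @ x' @ y' # s
     \<and> r \<le> length x"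
proof (induction x arbitrary: e)
  case Nil
  have "foldr push_letter (replicate e y) (y' # s) = replicate e y @ y' # s"
  proof (induction e)
    case (Suc e)
    then show ?case using assms by (cases e) auto
  qed simp
  then show ?case by (intro exI[of _ 0] exI[of _ "[]"]) simp
next
  case (Cons l x)
  show ?case
  proof (cases "l = inv_letter y \<and> e > 0")
    case True
    then obtain e' where e': "e = Suc e'" by (cases e) auto
    obtain r x' where "foldr push_letter (replicate e' y) (x @ y' # s) = replicate (e' - r) y @ x' @ y' # s"
      "r \<le> length x" using Cons by blast
    then show ?thesis using True e'
      by (intro exI[of _ "Suc r"] exI[of _ x'])
        (simp add: funpow_swap1)
  next
    case False
    have "foldr push_letter (replicate e y) (l # x @ y' # s) = replicate e y @ l # x @ y' # s"
      using False
    proof (induction e)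
      case (Suc e)
      then show ?case by (cases e) auto
    qed simp
    then show ?thesis by (intro exI[of _ 0] exI[of _ "l # x"]) simp
  qed
qed

definition word_prod :: "'a letters list \<Rightarrow> 'a letters" where
  "word_prod ws = foldr (\<lambda>w. foldr push_letter w) ws []"

lemma word_prod_simps [simp]:
  "word_prod [] = []" "word_prod (w # ws) = foldr push_letter w (word_prod ws)"
  by (simp_all add: word_prod_def)

lemma reduced_word_prod: "freely_reduced (word_prod ws)"
  by (induction ws) (auto intro: reduced_mult)

lemma word_prod_append:
  "word_prod (vs @ ws) = foldr push_letter (word_prod vs) (word_prod ws)"
  by (induction vs) (simp_all add: word_mult_assoc reduced_word_prod)

lemma word_prod_trivial: "\<forall>w\<in>set ws. w = [] \<Longrightarrow> word_prod ws = []"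
  by (induction ws) simp_all

lemma concat_replicate_replicate: "concat (replicate m (replicate n x)) = replicate (m * n) x"
  by (induction m) (auto simp: replicate_add)

lemma power_conjugate_replicate:
  assumes "freely_reduced (c @ replicate p y @ formal_inv c)" "0 < p"
  shows "(c @ replicate p y @ formal_inv c) [^]\<^bsub>free_group A\<^esub> int (Suc k)
      = c @ replicate (Suc k * p) y @ formal_inv c"
    and "freely_reduced (c @ replicate (Suc k * p) y @ formal_inv c)"
proof -
  have y: "replicate p y \<noteq> []" "hd (replicate p y) \<noteq> inv_letter (last (replicate p y))"
    using assms(2) by simp_all
  show "(c @ replicate p y @ formal_inv c) [^]\<^bsub>free_group A\<^esub> int (Suc k)
      = c @ replicate (Suc k * p) y @ formal_inv c"
    unfolding int_pow_int power_conjugate[OF assms(1) y] concat_replicate_replicate ..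
  show "freely_reduced (c @ replicate (Suc k * p) y @ formal_inv c)"
    using reduced_conjugate_power[OF assms(1) y, of k] unfolding concat_replicate_replicate .
qed

text \<open>
  The bound \<open>C < e\<close> makes the induction work: the block \<open>y (hd ns)\<close> is too long to be cancelled by the
  conjugating word of the next factor on the left.
\<close>

lemma large_powers:
  fixes c :: "'n \<Rightarrow> 'a letters" and W :: "'n \<Rightarrow> 'a letters"
  assumes "ns \<noteq> []"
    and "\<And>n. n \<in> set ns \<Longrightarrow> W n = c n @ replicate (p n) (y n) @ formal_inv (c n)"
    and "\<And>n. n \<in> set ns \<Longrightarrow> freely_reduced (W n)"
    and "\<And>n. n \<in> set ns \<Longrightarrow> 0 < p n"
    and "\<And>n. n \<in> set ns \<Longrightarrow> length (c n) \<le> C"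
    and "successively (\<lambda>m n. fst (y m) \<noteq> fst (y n)) ns"
  shows "\<exists>Q e s. map fst Q = ns \<and> C < e \<and> subseq (map y (tl ns)) s \<and>
     word_prod (map (\<lambda>(n, z). W n [^]\<^bsub>free_group A\<^esub> (z::int)) Q) = c (hd ns) @ replicate e (y (hd ns)) @ s"
  using assms
proof (induction ns rule: list_nonempty_induct)
  case (single n)
  let ?w = "c n @ replicate (p n) (y n) @ formal_inv (c n)"
  have w: "W n = ?w" "freely_reduced ?w" "0 < p n"
    using single(1-3)[of n] by simp_all
  have W: "W n [^]\<^bsub>free_group A\<^esub> int (Suc C) = c n @ replicate (Suc C * p n) (y n) @ formal_inv (c n)"
    unfolding w(1) by (rule power_conjugate_replicate[OF w(2,3)])
  have "word_prod [W n [^]\<^bsub>free_group A\<^esub> int (Suc C)] = W n [^]\<^bsub>free_group A\<^esub> int (Suc C)"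
    unfolding W using power_conjugate_replicate(2)[OF w(2,3)] by (simp only: word_prod_simps mult_Nil_right)
  moreover have "C < Suc C * p n"
    using w(3) by (cases "p n") auto
  ultimately show ?case using W
    by (intro exI[of _ "[(n, int (Suc C))]"] exI[of _ "Suc C * p n"] exI[of _ "formal_inv (c n)"]) simp
next
  case (cons n ns)
  have w: "W n = c n @ replicate (p n) (y n) @ formal_inv (c n)"
      "freely_reduced (c n @ replicate (p n) (y n) @ formal_inv (c n))" "0 < p n"
    using cons.prems(1-3)[of n] by simp_all
  define m where "m = hd ns"
  have ns: "ns = m # tl ns" using cons by (simp add: m_def)
  have "successively (\<lambda>m n. fst (y m) \<noteq> fst (y n)) (n # m # tl ns)"
    using cons.prems(5) unfolding ns[symmetric] .
  then have neq: "fst (y n) \<noteq> fst (y m)" and "successively (\<lambda>m n. fst (y m) \<noteq> fst (y n)) (m # tl ns)"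
    by simp_all
  then have succ: "successively (\<lambda>m n. fst (y m) \<noteq> fst (y n)) ns"
    unfolding ns[symmetric] by simp
  obtain Q e s where Q: "map fst Q = ns" "C < e" "subseq (map y (tl ns)) s"
    and R: "word_prod (map (\<lambda>(n, z). W n [^]\<^bsub>free_group A\<^esub> (z::int)) Q) = c m @ replicate e (y m) @ s"
    using cons.IH[OF _ _ _ _ succ] cons.prems m_def by auto
  let ?R = "word_prod (map (\<lambda>(n, z). W n [^]\<^bsub>free_group A\<^esub> (z::int)) Q)"
  obtain e' where e': "e = Suc e'" using Q by (cases e) auto
  \<comment> \<open>The last letter of the block is split off. The at least \<open>C\<close> letters
    before it absorb \<open>formal_inv (c n)\<close>, and it remains as the barrier for the power of
    \<open>y n\<close>.\<close>
  have R': "?R = (c m @ replicate e' (y m)) @ y m # s"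
    unfolding R e' by (simp flip: replicate_append_same)
  have "length (formal_inv (c n)) \<le> length (c m @ replicate e' (y m))"
    using cons.prems(4)[of n] Q(2) e' by simp
  from mult_append_long[OF this, of "y m # s"] obtain x
    where x: "foldr push_letter (formal_inv (c n)) ?R = x @ y m # s" unfolding R' by blast
  \<comment> \<open>At most \<open>length x\<close> copies of \<open>y n\<close> get lost, so this
    exponent leaves more than \<open>C\<close> of them.\<close>
  define k where "k = C + length x"
  have "k < Suc k * p n" using w(3) by (cases "p n") auto
  obtain r x' where x': "foldr push_letter (replicate (Suc k * p n) (y n)) (x @ y m # s)
       = replicate (Suc k * p n - r) (y n) @ x' @ y m # s" "r \<le> length x"
    using mult_replicate[OF neq] by blast
  define f where "f = Suc k * p n - r"
  have f: "C < f" unfolding f_def using \<open>k < Suc k * p n\<close> x'(2) unfolding k_def by linarith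
  have tail: "foldr push_letter (replicate (Suc k * p n) (y n) @ formal_inv (c n)) ?R = replicate f (y n) @ x' @ y m # s"
    by (simp only: foldr_append x x'(1) f_def)
  then have "freely_reduced (replicate f (y n) @ x' @ y m # s)"
    using reduced_mult[OF reduced_word_prod] by metis
  moreover have "0 < f" using f by simp
  \<comment> \<open>The border between \<open>c n\<close> and the power of \<open>y n\<close>
    already occurs in \<open>W n\<close>, so nothing cancels there.\<close>
  ultimately have "freely_reduced (c n @ replicate f (y n) @ x' @ y m # s)"
    using w(2,3) by (simp add: reduced_append hd_append)
  then have "foldr push_letter (c n) (replicate f (y n) @ x' @ y m # s) = c n @ replicate f (y n) @ x' @ y m # s"
    by (rule mult_reduced)
  moreover have "W n [^]\<^bsub>free_group A\<^esub> int (Suc k) = c n @ replicate (Suc k * p n) (y n) @ formal_inv (c n)"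
    unfolding w(1) by (rule power_conjugate_replicate[OF w(2,3)])
  ultimately have "word_prod (map (\<lambda>(n, z). W n [^]\<^bsub>free_group A\<^esub> (z::int)) ((n, int (Suc k)) # Q))
    = c n @ replicate f (y n) @ x' @ y m # s"
    by (simp only: list.map prod.case word_prod_simps foldr_append[of _ "c n"] tail)
  moreover have "subseq (map y ns) (x' @ y m # s)"
    by (subst ns) (use Q(3) in \<open>simp add: list_emb_append2\<close>)
  ultimately show ?case
    using Q(1) f by (intro exI[of _ "(n, int (Suc k)) # Q"] exI[of _ f] exI[of _ "x' @ y m # s"]) simp
qed


section \<open>Deleting letters\<close>

text \<open>Deleting letters by name and then reducing is the endomorphism of the free group that
  kills those generators. It respects cancellation because a letter and its inverse are deleted
  together.\<close>

lemma push_letter_filter: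
  "foldr push_letter (filter (\<lambda>l. P (fst l)) (push_letter l w)) []
    = foldr push_letter (filter (\<lambda>l. P (fst l)) (l # w)) []"
proof (cases w)
  case (Cons l' w')
  then show ?thesis
    using push_push_inv[OF reduced_mult[of "[]" "filter (\<lambda>l. P (fst l)) w'"]] by auto
qed simp

lemma mult_filter:
  "foldr push_letter (filter (\<lambda>l. P (fst l)) (foldr push_letter u v)) []
    = foldr push_letter (filter (\<lambda>l. P (fst l)) (u @ v)) []"
proof (induction u)
  case (Cons l u)
  have "foldr push_letter (filter (\<lambda>l. P (fst l)) (foldr push_letter (l # u) v)) []
    = foldr push_letter (filter (\<lambda>l. P (fst l)) (l # foldr push_letter u v)) []"
    by (simp only: push_letter_filter foldr_Cons o_apply)
  then show ?case using Cons by auto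
qed simp

lemma reduce_formal_inv: "foldr push_letter (formal_inv u) [] = formal_inv (foldr push_letter u [])"
proof -
  let ?r = "foldr push_letter u []"
  have r: "freely_reduced (formal_inv ?r)" by (intro reduced_formal_inv reduced_mult) simp
  have "[] = foldr push_letter ?r (formal_inv ?r)" by (simp only: mult_formal_inv_Nil)
  also have "\<dots> = foldr push_letter u (formal_inv ?r)" using r by (simp add: word_mult_assoc)
  finally show ?thesis using mult_formal_inv_left[OF r, of u] by simp
qed

lemma reduce_conjugate_trivial:
  assumes "foldr push_letter v [] = []"
  shows "foldr push_letter (c @ v @ formal_inv c) [] = []"
proof -
  have "foldr push_letter v (foldr push_letter (formal_inv c) []) = foldr push_letter (formal_inv c) []"
    using word_mult_assoc[of "foldr push_letter (formal_inv c) []" v "[]"] assms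
    by (simp add: reduced_mult)
  then show ?thesis by (simp add: mult_formal_inv_right)
qed

lemma reduce_conjugate_trivialD:
  assumes "foldr push_letter (c @ v @ formal_inv c) [] = []"
  shows "foldr push_letter v [] = []"
proof -
  have "foldr push_letter (formal_inv c @ (c @ v @ formal_inv c) @ c) [] = []"
    using reduce_conjugate_trivial[OF assms, of "formal_inv c"] by (simp add: rev_map o_def)
  moreover have "foldr push_letter (formal_inv c @ (c @ v @ formal_inv c) @ c) []
      = foldr push_letter (formal_inv c) (foldr push_letter c (foldr push_letter v (foldr push_letter (formal_inv c) (foldr push_letter c []))))"
    by simp
  ultimately show ?thesis by (simp only: mult_formal_inv_left[OF reduced_mult] reduced_simps mult_formal_inv_left)
qed

section \<open>Coordinates of elements of \<open>H\<close>\<close>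

lemma mult_free_group [simp]: "u \<otimes>\<^bsub>free_group A\<^esub> v = foldr push_letter u v"
  and one_free_group [simp]: "\<one>\<^bsub>free_group A\<^esub> = []"
  by (simp_all add: free_group_def)

lemma carrier_free_group: "w \<in> carrier (free_group A) \<longleftrightarrow> freely_reduced w \<and> fst ` set w \<subseteq> A"
  by (simp add: free_group_def)

lemma inv_free_group:
  assumes "w \<in> carrier (free_group A)" shows "inv\<^bsub>free_group A\<^esub> w = formal_inv w"
proof -
  interpret group "free_group A" by (rule group_free_group)
  show ?thesis
    using assms by (intro inv_equality) (force simp: mult_inv_word carrier_free_group reduced_formal_inv)+
qed

lemma letters_power:
  assumes "a \<in> A"
  shows "fst ` set (free_gen a [^]\<^bsub>free_group A\<^esub> (z::int)) \<subseteq> {a}"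
proof -
  interpret group "free_group A" by (rule group_free_group)
  have gen: "free_gen a \<in> carrier (free_group A)"
    using assms by (simp add: carrier_free_group free_gen_def)
  have *: "fst ` set (free_gen a [^]\<^bsub>free_group A\<^esub> n) \<subseteq> {a}" for n :: nat
  proof (induction n)
    case (Suc n)
    then show ?case
      using letters_mult[of "free_gen a [^]\<^bsub>free_group A\<^esub> n" "free_gen a"] by (simp add: free_gen_def) blast
  qed simp
  show ?thesis
  proof (cases "z < 0")
    case True
    then have "free_gen a [^]\<^bsub>free_group A\<^esub> z = inv\<^bsub>free_group A\<^esub> (free_gen a [^]\<^bsub>free_group A\<^esub> nat (- z))"
      unfolding int_pow_def2 by simp
    also have "\<dots> = formal_inv (free_gen a [^]\<^bsub>free_group A\<^esub> nat (- z))"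
      by (rule inv_free_group) (rule nat_pow_closed[OF gen])
    finally show ?thesis using *[of "nat (- z)"] by (simp add: image_image)
  next
    case False
    then show ?thesis using *[of "nat z"] unfolding int_pow_def2 by simp
  qed
qed

locale alphabet =
  fixes N :: "'a set" and ul :: "nat \<Rightarrow> 'a"
  assumes bij_ul: "bij_betw ul UNIV N"
begin

definition idx :: "'a \<times> bool \<Rightarrow> nat" where
  "idx l = inv_into UNIV ul (fst l)"

abbreviation "F \<equiv> free_group N"
abbreviation "G \<equiv> G_group N"
abbreviation "H \<equiv> H_group N ul"
abbreviation "T \<equiv> H_topology N ul"
abbreviation "g \<equiv> g_elem N ul"

lemma inj_ul: "inj ul" and range_ul: "range ul = N"
  using bij_ul by (auto simp: bij_betw_def)

lemma ul_in [simp]: "ul n \<in> N"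
  using range_ul by auto

lemma idx_ul [simp]: "fst l = ul n \<Longrightarrow> idx l = n"
  by (simp add: idx_def inj_ul)

lemma ul_idx: "fst l \<in> N \<Longrightarrow> ul (idx l) = fst l"
  unfolding idx_def using range_ul by (metis f_inv_into_f)

lemma map_idx_formal_inv: "map idx (formal_inv w) = rev (map idx w)"
  by (simp add: idx_def rev_map o_def)

lemma filter_formal_inv:
  "filter (\<lambda>l. idx l \<le> i) (formal_inv c) = formal_inv (filter (\<lambda>l. idx l \<le> i) c)"
  by (simp add: filter_map o_def idx_def flip: rev_filter)

sublocale F: group F
  by (rule group_free_group)

lemma group_G: "group G"
  unfolding G_group_def by (simp add: group_free_group)

lemma gen_in_F [simp]: "free_gen (ul n) \<in> carrier F"
  by (simp add: carrier_free_group free_gen_def)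

lemma g_in_G: "g z \<in> carrier G"
  using range_ul by (intro g_elem_in_carrier) simp

sublocale H: group H
  unfolding H_group_def by (intro group.group_subgroup_generated group_G)

lemma carrier_H_subset: "carrier H \<subseteq> carrier G"
  unfolding H_group_def by (rule group.carrier_subgroup_generated_subset[OF group_G])

lemma H_nth [simp]: "h \<in> carrier H \<Longrightarrow> h i \<in> carrier F"
  using carrier_H_subset by (auto simp: G_group_def)

lemma H_nth_reduced: "h \<in> carrier H \<Longrightarrow> freely_reduced (h i)"
  using H_nth carrier_free_group by blast

lemma mult_H: "(x \<otimes>\<^bsub>H\<^esub> y) i = foldr push_letter (x i) (y i)"
  and one_H: "\<one>\<^bsub>H\<^esub> i = []"
  by (simp_all add: H_group_def G_group_def)

lemma hom_nth: "(\<lambda>x. x i) \<in> hom H F"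
  by (auto simp: hom_def mult_H)

lemma inv_H: "x \<in> carrier H \<Longrightarrow> (inv\<^bsub>H\<^esub> x) i = formal_inv (x i)"
  using group_hom.hom_inv[of H F "\<lambda>x. x i" x] hom_nth
  by (simp add: group_hom_def group_hom_axioms_def H.group_axioms F.group_axioms inv_free_group)

lemma int_pow_H: "x \<in> carrier H \<Longrightarrow> (x [^]\<^bsub>H\<^esub> (z::int)) i = x i [^]\<^bsub>F\<^esub> z"
  using hom_int_pow[OF hom_nth, of x] H.group_axioms F.group_axioms by simp

lemma g_in_H [simp]: "g z \<in> carrier H"
  unfolding H_group_def carrier_subgroup_generated using g_in_G by (auto intro: generate.incl)

lemma H_induct [consumes 1, case_names one gen inv mult]:
  assumes "h \<in> carrier H" and "P \<one>\<^bsub>H\<^esub>" and gen: "\<And>z. P (g z)"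
    and inv: "\<And>x. x \<in> carrier H \<Longrightarrow> P x \<Longrightarrow> P (inv\<^bsub>H\<^esub> x)"
    and mult: "\<And>x y. x \<in> carrier H \<Longrightarrow> y \<in> carrier H \<Longrightarrow> P x \<Longrightarrow> P y \<Longrightarrow> P (x \<otimes>\<^bsub>H\<^esub> y)"
  shows "P h"
proof -
  have inv_eq: "inv\<^bsub>H\<^esub> x = inv\<^bsub>G\<^esub> x" if "x \<in> carrier H" for x
    using that unfolding H_group_def by (rule group.inv_subgroup_generated[OF group_G])
  have eq: "carrier H = generate G (carrier G \<inter> range g)"
    unfolding H_group_def carrier_subgroup_generated ..
  have "h \<in> generate G (carrier G \<inter> range g)"
    using assms(1) eq by simp
  then show ?thesis
  proof (induction rule: generate.induct)
    case one
    then show ?case using assms(2) by (simp add: H_group_def)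
  next
    case (incl h)
    then show ?case using gen by auto
  next
    case (inv h)
    then show ?case using gen assms(4) inv_eq g_in_H by (metis Int_iff imageE)
  next
    case (eng h1 h2)
    then show ?case using mult[of h1 h2] eq by (simp add: H_group_def)
  qed
qed

lemma g_0: "g z 0 = free_gen (ul 0) [^]\<^bsub>F\<^esub> z 0"
  and g_Suc: "g z (Suc i) = foldr push_letter (g z i) (free_gen (ul (Suc i)) [^]\<^bsub>F\<^esub> z (Suc i))"
  by (simp_all add: g_elem_def)

lemma idx_power: "l \<in> set (free_gen (ul n) [^]\<^bsub>F\<^esub> (z::int)) \<Longrightarrow> idx l = n"
  using letters_power[OF ul_in, of n z] by auto

text \<open>Before reduction the powers stand in the order of their indices, and reduction keeps a
  subsequence.\<close>

lemma sorted_g: "sorted (map idx (g z i)) \<and> (\<forall>l\<in>set (g z i). idx l \<le> i)"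
proof (induction i)
  case 0
  then show ?case
    by (auto simp: g_0 sorted_wrt_map intro!: sorted_wrt_mono_rel[OF _ sorted_wrt_true] dest!: idx_power)
next
  case (Suc i)
  let ?p = "free_gen (ul (Suc i)) [^]\<^bsub>F\<^esub> z (Suc i)"
  have sub: "subseq (g z (Suc i)) (g z i @ ?p)"
    unfolding g_Suc by (rule subseq_mult)
  have "sorted (map idx ?p)"
    by (auto simp: sorted_wrt_map intro!: sorted_wrt_mono_rel[OF _ sorted_wrt_true] dest!: idx_power)
  then have "sorted (map idx (g z i @ ?p))"
    using Suc by (fastforce simp: sorted_append dest!: idx_power)
  then have "sorted (map idx (g z (Suc i)))"
    using sub sorted_subseq subseq_map by blast
  moreover have "set (g z (Suc i)) \<subseteq> set (g z i) \<union> set ?p"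
    using sub by (metis set_append set_nths_subset subseq_conv_nths)
  ultimately show ?case using Suc by (fastforce dest!: idx_power)
qed

text \<open>A generator has one block in every coordinate, inversion reverses the words, and
  multiplication adds the bounds; so one bound serves all coordinates.\<close>

lemma H_blocks: "h \<in> carrier H \<Longrightarrow> \<exists>k. \<forall>i. mono_blocks k (map idx (h i))"
proof (induction rule: H_induct)
  case one
  then show ?case by (simp add: one_H)
next
  case (gen z)
  then show ?case using sorted_g blocks_1 by blast
next
  case (inv x)
  then show ?case using blocks_rev by (metis inv_H map_idx_formal_inv)
next
  case (mult x y)
  then obtain j k where "mono_blocks j (map idx (x i))" "mono_blocks k (map idx (y i))" for i by blast
  then have "mono_blocks (j + k) (map idx ((x \<otimes>\<^bsub>H\<^esub> y) i))" for i
    unfolding mult_H using blocks_append blocks_subseq subseq_map[OF subseq_mult, of idx]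
    by (metis map_append)
  then show ?case by blast
qed

text \<open>Both sides are homomorphisms in \<open>h\<close>, so generators suffice; there, each
  step from a coordinate to the next appends a power of a letter that is deleted. This ties the
  coordinates of an element of \<open>H\<close> together.\<close>

lemma H_filter:
  assumes "h \<in> carrier H" "i \<le> j"
  shows "foldr push_letter (filter (\<lambda>l. idx l \<le> i) (h j)) [] = h i"
  using assms(1)
proof (induction rule: H_induct)
  case one
  then show ?case by (simp add: one_H)
next
  case (gen z)
  show ?case using assms(2)
  proof (induction j rule: dec_induct)
    case base
    then show ?case using sorted_g[of z i] by (simp add: filter_id_conv[THEN iffD2] mult_Nil_right H_nth_reduced)
  next
    case (step j)
    have "filter (\<lambda>l. idx l \<le> i) (free_gen (ul (Suc j)) [^]\<^bsub>F\<^esub> z (Suc j)) = []"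
      using step by (auto simp: filter_empty_conv dest!: idx_power)
    then show ?case
      using step mult_filter[of "\<lambda>a. inv_into UNIV ul a \<le> i"] by (simp add: g_Suc idx_def)
  qed
next
  case (inv x)
  then show ?case by (simp add: inv_H filter_formal_inv reduce_formal_inv)
next
  case (mult x y)
  have "foldr push_letter (filter (\<lambda>l. idx l \<le> i) ((x \<otimes>\<^bsub>H\<^esub> y) j)) []
    = foldr push_letter (filter (\<lambda>l. idx l \<le> i) (x j)) (y i)"
    using mult_filter[of "\<lambda>a. inv_into UNIV ul a \<le> i"] mult by (simp add: mult_H idx_def)
  also have "\<dots> = foldr push_letter (x i) (y i)"
    using word_mult_assoc[OF H_nth_reduced[OF mult(2)], of "filter (\<lambda>l. idx l \<le> i) (x j)" "[]"] mult by simp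
  finally show ?case by (simp add: mult_H)
qed

section \<open>Topology of \<open>H\<close>\<close>

text \<open>These sets are the basic neighbourhoods of \<open>h\<close>, because the factors of the
  product are discrete.\<close>

definition cylinder :: "(nat \<Rightarrow> 'a letters) \<Rightarrow> nat \<Rightarrow> (nat \<Rightarrow> 'a letters) set" where
  "cylinder h n = {x \<in> carrier H. \<forall>i<n. x i = h i}"

lemma cylinder_self: "h \<in> carrier H \<Longrightarrow> h \<in> cylinder h n"
  by (simp add: cylinder_def)

lemma topspace_T [simp]: "topspace T = carrier H"
  using carrier_H_subset by (auto simp: H_topology_def G_topology_def G_group_def)

lemma openin_cylinder:
  assumes "h \<in> carrier H" shows "openin T (cylinder h n)"
proof -
  let ?U = "\<lambda>i. if i < n then {h i} else carrier F"
  have eq: "cylinder h n = PiE UNIV ?U \<inter> carrier H"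
    by (auto simp: cylinder_def PiE_iff split: if_splits)
  have "{i. ?U i \<noteq> carrier F} \<subseteq> {..<n}" by auto
  then have "finite {i. ?U i \<noteq> carrier F}" by (rule finite_subset) simp
  then have "openin (G_topology N) (PiE UNIV ?U)"
    unfolding G_topology_def openin_PiE_gen using assms by simp
  then show ?thesis unfolding eq H_topology_def openin_subtopology by blast
qed

lemma openin_T_cylinder:
  assumes "openin T U" "h \<in> U"
  shows "\<exists>n. cylinder h n \<subseteq> U"
proof -
  obtain W where W: "openin (G_topology N) W" "U = W \<inter> carrier H"
    using assms(1) by (auto simp: H_topology_def openin_subtopology)
  then obtain V where V: "finite {i. V i \<noteq> carrier F}" "h \<in> PiE UNIV V" "PiE UNIV V \<subseteq> W"
    using assms(2) by (auto simp: G_topology_def openin_product_topology_alt)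
  obtain n where n: "\<forall>i\<in>{i. V i \<noteq> carrier F}. i < n"
    using V(1) finite_nat_set_iff_bounded by blast
  have "x \<in> PiE UNIV V" if "x \<in> cylinder h n" for x
    unfolding PiE_iff
  proof (intro conjI ballI)
    show "x i \<in> V i" for i
    proof (cases "i < n")
      case True
      then show ?thesis using that V(2) by (auto simp: cylinder_def PiE_iff)
    next
      case False
      then have "V i = carrier F" using n by blast
      then show ?thesis using that by (simp add: cylinder_def)
    qed
  qed simp
  then have "cylinder h n \<subseteq> W" using V(3) by blast
  moreover have "cylinder h n \<subseteq> carrier H" by (auto simp: cylinder_def)
  ultimately show ?thesis using W(2) by blast
qed

lemma topological_group_H: "topological_group H T"
proof (intro topological_group.intro topological_group_axioms.intro)
  show "group H" by (rule H.group_axioms)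
  show "topspace T = carrier H" by simp
  show "continuous_map (prod_topology T T) T (\<lambda>(x, y). x \<otimes>\<^bsub>H\<^esub> y)"
    unfolding continuous_map_def
  proof (intro conjI allI impI)
    fix U assume U: "openin T U"
    let ?P = "{x \<in> topspace (prod_topology T T). (case x of (x, y) \<Rightarrow> x \<otimes>\<^bsub>H\<^esub> y) \<in> U}"
    show "openin (prod_topology T T) ?P"
      unfolding openin_subopen[of _ ?P]
    proof
      fix p assume "p \<in> ?P"
      then obtain x y where p: "p = (x, y)" "x \<in> carrier H" "y \<in> carrier H" "x \<otimes>\<^bsub>H\<^esub> y \<in> U"
        by auto
      then obtain n where n: "cylinder (x \<otimes>\<^bsub>H\<^esub> y) n \<subseteq> U"
        using openin_T_cylinder[OF U] by blast
      let ?C = "cylinder x n \<times> cylinder y n"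
      have "openin (prod_topology T T) ?C"
        using p by (simp add: openin_prod_Times_iff openin_cylinder)
      moreover have "?C \<subseteq> ?P"
        using n by (auto simp: cylinder_def mult_H)
      moreover have "p \<in> ?C" using p by (simp add: cylinder_self)
      ultimately show "\<exists>V. openin (prod_topology T T) V \<and> p \<in> V \<and> V \<subseteq> ?P" by blast
    qed
  qed auto
  show "continuous_map T T (\<lambda>x. inv\<^bsub>H\<^esub> x)"
    unfolding continuous_map_def
  proof (intro conjI allI impI)
    fix U assume U: "openin T U"
    let ?P = "{x \<in> topspace T. inv\<^bsub>H\<^esub> x \<in> U}"
    show "openin T ?P"
      unfolding openin_subopen[of _ ?P]
    proof
      fix x assume x: "x \<in> ?P"
      then obtain n where "cylinder (inv\<^bsub>H\<^esub> x) n \<subseteq> U"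
        using openin_T_cylinder[OF U] by blast
      then have "cylinder x n \<subseteq> ?P"
        using x by (auto simp: cylinder_def inv_H)
      then show "\<exists>V. openin T V \<and> x \<in> V \<and> V \<subseteq> ?P"
        using x by (intro exI[of _ "cylinder x n"]) (simp add: openin_cylinder cylinder_self)
    qed
  qed auto
  show "Hausdorff_space T"
    by (simp add: H_topology_def G_topology_def Hausdorff_space_subtopology Hausdorff_space_product_topology)
qed

lemma metrizable_space_T: "metrizable_space T"
  by (simp add: H_topology_def G_topology_def metrizable_space_subtopology metrizable_space_product_topology)

lemma linear_topology_H: "linear_topology H T"
proof -
  \<comment> \<open>This cylinder is the kernel of the projection to the first \<open>n\<close>
    coordinates.\<close>
  have "subgroup (cylinder \<one>\<^bsub>H\<^esub> n) H" for n
    by (rule H.subgroupI) (auto simp: cylinder_def mult_H inv_H one_H)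
  moreover have "openin T (cylinder \<one>\<^bsub>H\<^esub> n)" for n
    by (intro openin_cylinder H.one_closed)
  ultimately have "\<forall>V\<in>range (cylinder \<one>\<^bsub>H\<^esub>). subgroup V H \<and> openin T V" by blast
  moreover have "\<exists>V\<in>range (cylinder \<one>\<^bsub>H\<^esub>). V \<subseteq> U" if "openin T U \<and> \<one>\<^bsub>H\<^esub> \<in> U" for U
    using that openin_T_cylinder[of U "\<one>\<^bsub>H\<^esub>"] by blast
  ultimately show ?thesis
    unfolding linear_topology_def using topological_group_H by blast
qed

lemma separable_space_T: "separable_space T"
proof -
  have "countable N"
    unfolding range_ul[symmetric] by simp
  then have "countable (lists (lists (N \<times> (UNIV :: bool set))))" by simp
  moreover have F: "carrier F \<subseteq> lists (N \<times> UNIV)"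
    by (fastforce simp: carrier_free_group in_lists_conv_set mem_Times_iff)
  have prefix: "map h [0..<n] \<in> lists (lists (N \<times> UNIV))" if "h \<in> carrier H" for h n
  proof (rule in_listsI, rule ballI)
    fix w assume "w \<in> set (map h [0..<n])"
    then have "w \<in> carrier F" using H_nth[OF that] by auto
    then show "w \<in> lists (N \<times> UNIV)" using F by blast
  qed
  have "(\<lambda>(h, n). map h [0..<n]) ` (carrier H \<times> UNIV) \<subseteq> lists (lists (N \<times> UNIV))"
  proof (rule image_subsetI)
    fix p assume "p \<in> carrier H \<times> (UNIV :: nat set)"
    then show "(case p of (h, n) \<Rightarrow> map h [0..<n]) \<in> lists (lists (N \<times> UNIV))"
      by (cases p) (simp only: prod.case mem_Times_iff fst_conv prefix)
  qed
  ultimately have prefixes: "countable ((\<lambda>(h, n). map h [0..<n]) ` (carrier H \<times> UNIV))" (is "countable ?P")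
    by (rule countable_subset[rotated])
  \<comment> \<open>One element of \<open>H\<close> is chosen for each prefix that occurs in
    \<open>H\<close>. The choices are dense, since a cylinder constrains only a prefix, and
    countable, since the alphabet is.\<close>
  define rep where "rep p = (SOME h. h \<in> carrier H \<and> map h [0..<length p] = p)" for p
  have rep: "rep (map h [0..<n]) \<in> cylinder h n" if "h \<in> carrier H" for h n
  proof -
    let ?R = "\<lambda>x. x \<in> carrier H \<and> map x [0..<length (map h [0..<n])] = map h [0..<n]"
    have "?R h" using that by simp
    then have "?R (rep (map h [0..<n]))" unfolding rep_def by (rule someI[where P = ?R])
    then show ?thesis by (simp add: cylinder_def)
  qed
  have "h \<in> T closure_of (rep ` ?P)" if "h \<in> carrier H" for h
    unfolding in_closure_of
  proof (intro conjI allI impI)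
    show "h \<in> topspace T" using that by simp
    fix U assume "h \<in> U \<and> openin T U"
    then obtain n where "cylinder h n \<subseteq> U" using openin_T_cylinder by blast
    then have "rep (map h [0..<n]) \<in> U" using rep[OF that] by (rule subsetD)
    moreover have "rep (map h [0..<n]) \<in> rep ` ?P"
      by (intro imageI image_eqI[of _ _ "(h, n)"]) (simp_all add: that)
    ultimately show "\<exists>y. y \<in> rep ` ?P \<and> y \<in> U" by (intro exI conjI)
  qed
  moreover have "rep ` ?P \<subseteq> topspace T"
    using rep by (auto simp: cylinder_def)
  ultimately show ?thesis
    unfolding separable_space_def using countable_image[OF prefixes, of rep] closure_of_subset_topspace[of T]
    by (intro exI[of _ "rep ` ?P"]) (simp add: subset_antisym subsetI)
qed

text \<open>A neighbourhood constrains finitely many coordinates, each of them in a discrete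
  space.\<close>

lemma limitin_T:
  assumes "\<And>m. f m \<in> carrier H"
  shows "limitin T f h sequentially \<longleftrightarrow> h \<in> carrier H \<and> (\<forall>i. \<forall>\<^sub>F m in sequentially. f m i = h i)"
proof
  assume L: "limitin T f h sequentially"
  then have h: "h \<in> carrier H" using limitin_topspace by fastforce
  have "\<forall>\<^sub>F m in sequentially. f m i = h i" for i
  proof -
    have "\<forall>\<^sub>F m in sequentially. f m \<in> cylinder h (Suc i)"
      using L openin_cylinder[OF h] cylinder_self[OF h] by (auto simp: limitin_def)
    then show ?thesis by (rule eventually_mono) (simp add: cylinder_def)
  qed
  with h show "h \<in> carrier H \<and> (\<forall>i. \<forall>\<^sub>F m in sequentially. f m i = h i)" by blast
next
  assume R: "h \<in> carrier H \<and> (\<forall>i. \<forall>\<^sub>F m in sequentially. f m i = h i)"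
  show "limitin T f h sequentially"
    unfolding limitin_def
  proof (intro conjI allI impI)
    fix U assume "openin T U \<and> h \<in> U"
    then obtain n where n: "cylinder h n \<subseteq> U" using openin_T_cylinder by blast
    have "\<forall>\<^sub>F m in sequentially. \<forall>i\<in>{..<n}. f m i = h i"
      using R by (intro eventually_ball_finite) auto
    then show "\<forall>\<^sub>F m in sequentially. f m \<in> U"
      by (rule eventually_mono) (use n assms in \<open>auto simp: cylinder_def\<close>)
  qed (use R in simp)
qed

section \<open>Productive sequences\<close>

lemma ordered_prod_closed: "range b \<subseteq> carrier H \<Longrightarrow> ordered_prod H b m \<in> carrier H"
  by (induction m) auto

lemma ordered_prod_nth:
  assumes "range b \<subseteq> carrier H"
  shows "ordered_prod H b m i = word_prod (map (\<lambda>n. b n i) [0..<Suc m])"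
proof (induction m)
  case 0
  have "freely_reduced (b 0 i)" using assms by (intro H_nth_reduced) auto
  then show ?case by (simp add: mult_Nil_right)
next
  case (Suc m)
  have "freely_reduced (b (Suc m) i)" using assms by (intro H_nth_reduced) auto
  then have "word_prod (map (\<lambda>n. b n i) [0..<Suc (Suc m)])
      = foldr push_letter (word_prod (map (\<lambda>n. b n i) [0..<Suc m])) (b (Suc m) i)"
    using word_prod_append[of "map (\<lambda>n. b n i) [0..<Suc m]" "[b (Suc m) i]"] by (simp add: mult_Nil_right)
  then show ?case by (simp only: ordered_prod.simps mult_H Suc)
qed

lemma productive_nth:
  assumes "productive H T b"
  shows "\<exists>h\<in>carrier H. \<forall>i. \<forall>\<^sub>F m in sequentially. word_prod (map (\<lambda>n. b n i) [0..<m]) = h i"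
proof -
  obtain h where b: "range b \<subseteq> carrier H" and "limitin T (ordered_prod H b) h sequentially"
    using assms by (auto simp: productive_def)
  then have "h \<in> carrier H" "\<forall>\<^sub>F m in sequentially. ordered_prod H b m i = h i" for i
    by (simp_all add: limitin_T ordered_prod_closed)
  \<comment> \<open>\<open>ordered_prod\<close> at \<open>m\<close> has \<open>m + 1\<close>
    factors, hence the shift of the index.\<close>
  moreover from this(2) have "\<forall>\<^sub>F m in sequentially. word_prod (map (\<lambda>n. b n i) [0..<m]) = h i" for i
    unfolding ordered_prod_nth[OF b] using eventually_sequentially_Suc by blast
  ultimately show ?thesis by blast
qed

section \<open>The sequence \<open>B\<close> and its bad rearrangement\<close>

definition basis_elem :: "nat \<Rightarrow> nat \<Rightarrow> 'a letters" where
  "basis_elem n = g (\<lambda>k. if k = n then 1 else 0)"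

lemma basis_elem_in_H [simp]: "basis_elem n \<in> carrier H"
  by (simp add: basis_elem_def)

lemma basis_elem_nth: "basis_elem n i = (if n \<le> i then free_gen (ul n) else [])"
proof (induction i)
  case 0
  then show ?case by (simp add: basis_elem_def g_0)
next
  case (Suc i)
  have "free_gen (ul (Suc i)) [^]\<^bsub>F\<^esub> (1::int) = free_gen (ul (Suc i))"
    by (rule F.int_pow_1) simp
  with Suc show ?case
    by (auto simp: basis_elem_def g_Suc free_gen_def le_Suc_eq)
qed

lemma inj_basis_elem: "inj basis_elem"
proof (rule injI)
  have "m \<le> n" if "basis_elem m = basis_elem n" for m n
    using that[THEN fun_cong, of n] by (simp add: basis_elem_nth free_gen_def split: if_splits)
  then show "m = n" if "basis_elem m = basis_elem n" for m n
    using that by (metis order_antisym)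
qed

lemma f_omega_productive_basis: "f_omega_productive H T basis_elem"
proof -
  have "productive H T (\<lambda>n. basis_elem n [^]\<^bsub>H\<^esub> z n)" for z :: "nat \<Rightarrow> int"
  proof -
    let ?b = "\<lambda>n. basis_elem n [^]\<^bsub>H\<^esub> z n"
    have b: "range ?b \<subseteq> carrier H" by auto
    have nth: "?b n i = (if n \<le> i then free_gen (ul n) [^]\<^bsub>F\<^esub> z n else [])" for n i
      using F.int_pow_one by (simp add: int_pow_H basis_elem_nth)
    \<comment> \<open>Factors with index above \<open>i\<close> are trivial in coordinate
      \<open>i\<close>, so that coordinate stops changing at \<open>m = i\<close>. The limit is the
      generator \<open>g z\<close> of \<open>H\<close>.\<close>
    have "ordered_prod H ?b m i = g z (min m i)" for m i
    proof (induction m)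
      case 0
      then show ?case by (simp add: nth g_0)
    next
      case (Suc m)
      show ?case
      proof (cases "Suc m \<le> i")
        case True
        then show ?thesis using Suc by (simp add: mult_H nth g_Suc min_def)
      next
        case False
        then have "min (Suc m) i = min m i" by simp
        then show ?thesis using Suc False by (simp add: mult_H nth mult_Nil_right H_nth_reduced)
      qed
    qed
    then have "\<forall>\<^sub>F m in sequentially. ordered_prod H ?b m i = g z i" for i
      by (intro eventually_mono[OF eventually_ge_at_top[of i]]) simp
    then have "limitin T (ordered_prod H ?b) (g z) sequentially"
      by (simp add: limitin_T ordered_prod_closed[OF b])
    then show ?thesis using b unfolding productive_def by blast
  qed
  then show ?thesis unfolding f_omega_productive_def using inj_basis_elem by auto
qed

lemma word_prod_letters: "freely_reduced (map f xs) \<Longrightarrow> word_prod (map (\<lambda>x. [f x]) xs) = map f xs"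
proof (induction xs)
  case (Cons x xs)
  then show ?case using reduced_tl[of "f x" "map f xs"] by (simp add: push_reduced)
qed simp

text \<open>If a limit had \<open>k\<close> blocks, its coordinate \<open>2 * k + 1\<close> would be
  the product of exactly the first \<open>2 * Suc k\<close> rearranged factors, which is a zigzag
  word of that length.\<close>

lemma not_productive_swap: "\<not> productive H T (\<lambda>n. basis_elem (swap_adjacent n))"
proof
  assume "productive H T (\<lambda>n. basis_elem (swap_adjacent n))"
  then obtain h where h: "h \<in> carrier H"
    and lim: "\<And>i. \<forall>\<^sub>F m in sequentially. word_prod (map (\<lambda>n. basis_elem (swap_adjacent n) i) [0..<m]) = h i"
    using productive_nth by blast
  obtain k where k: "\<And>i. mono_blocks k (map idx (h i))" using H_blocks[OF h] by blast
  define L where "L = 2 * Suc k"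
  define i where "i = 2 * k + 1"
  let ?w = "map (\<lambda>n. (ul (swap_adjacent n), True)) [0..<L]"
  obtain m0 where m0: "\<And>m. m \<ge> m0 \<Longrightarrow> word_prod (map (\<lambda>n. basis_elem (swap_adjacent n) i) [0..<m]) = h i"
    using lim[of i] unfolding eventually_sequentially by blast
  have swap_ge: "\<not> swap_adjacent n \<le> i" if "L \<le> n" for n
    using that swap_less[of n "Suc k"] by (simp add: i_def L_def)
  have swap_le: "swap_adjacent n \<le> i" if "n < L" for n
    using that swap_less[of n "Suc k"] by (simp add: i_def L_def)
  have first: "map (\<lambda>n. basis_elem (swap_adjacent n) i) [0..<L] = map (\<lambda>n. [(ul (swap_adjacent n), True)]) [0..<L]"
    using swap_le by (simp add: basis_elem_nth free_gen_def)
  have rest: "word_prod (map (\<lambda>n. basis_elem (swap_adjacent n) i) [L..<L + m0]) = []"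
    using swap_ge by (intro word_prod_trivial) (simp add: basis_elem_nth swap_ge)
  \<comment> \<open>All letters are positive, so nothing cancels.\<close>
  have red: "freely_reduced ?w"
    unfolding freely_reduced_def successively_map by (simp add: inv_letter_def successively_conv_nth)
  have "h i = word_prod (map (\<lambda>n. basis_elem (swap_adjacent n) i) ([0..<L] @ [L..<L + m0]))"
    using m0[of "L + m0"] upt_add_eq_append[of 0 "L" m0] by simp
  also have "\<dots> = ?w"
    unfolding map_append word_prod_append rest first word_prod_letters[OF red] using red by (rule mult_Nil_right)
  finally have "mono_blocks k (map idx ?w)" using k by metis
  moreover have "map idx ?w = map (\<lambda>i. id (swap_adjacent i)) [0..<L]" by simp
  ultimately have "length (map (\<lambda>i. id (swap_adjacent i)) [0..<L]) \<le> 2 * k"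
    by (metis zigzag_blocks zigzag_swap strict_mono_id)
  then show False by (simp add: L_def)
qed

section \<open>Finite products of powers, in the order of a list of index-exponent pairs\<close>

definition finite_prod :: "(nat \<Rightarrow> nat \<Rightarrow> 'a letters) \<Rightarrow> (nat \<times> int) list \<Rightarrow> nat \<Rightarrow> 'a letters" where
  "finite_prod a Q i = word_prod (map (\<lambda>(n, z). a n i [^]\<^bsub>F\<^esub> z) Q)"

lemma finite_prod_append:
  "finite_prod a (P @ Q) i = foldr push_letter (finite_prod a P i) (finite_prod a Q i)"
  by (simp add: finite_prod_def word_prod_append)

lemma power_Nil: "[] [^]\<^bsub>F\<^esub> (z::int) = []"
  using F.int_pow_one by simp

lemma finite_prod_trivial:
  assumes "\<And>n z. (n, z) \<in> set Q \<Longrightarrow> a n i = [] \<or> z = 0"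
  shows "finite_prod a Q i = []"
proof -
  have "a n i [^]\<^bsub>F\<^esub> z = []" if "(n, z) \<in> set Q" for n z
    using assms[OF that] by (auto simp: power_Nil)
  then show ?thesis
    unfolding finite_prod_def by (intro word_prod_trivial) auto
qed

lemma finite_prod_in_H:
  assumes "range a \<subseteq> carrier H"
  shows "\<exists>h\<in>carrier H. \<forall>i. h i = finite_prod a Q i"
proof (induction Q)
  case Nil
  show ?case by (intro bexI[of _ "\<one>\<^bsub>H\<^esub>"]) (simp_all add: one_H finite_prod_def)
next
  case (Cons p Q)
  then obtain h where h: "h \<in> carrier H" "\<And>i. h i = finite_prod a Q i" by blast
  obtain n z where p: "p = (n, z)" by (cases p)
  have "a n \<in> carrier H" using assms by auto
  then show ?case
    using h by (intro bexI[of _ "a n [^]\<^bsub>H\<^esub> z \<otimes>\<^bsub>H\<^esub> h"]) (simp_all add: p mult_H int_pow_H finite_prod_def)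
qed

section \<open>Unconditionally productive sequences\<close>

text \<open>Unconditional productivity read coordinatewise, where convergence means being eventually
  constant. The exponent \<open>z n\<close> belongs to the position \<open>n\<close>, not to the
  index \<open>\<phi> n\<close>.\<close>

definition unconditional :: "(nat \<Rightarrow> nat \<Rightarrow> 'a letters) \<Rightarrow> bool" where
  "unconditional a \<longleftrightarrow> range a \<subseteq> carrier H \<and> inj a \<and> (\<forall>\<phi> z. bij \<phi> \<longrightarrow>
     (\<exists>h\<in>carrier H. \<forall>i. \<forall>\<^sub>F m in sequentially. finite_prod a (map (\<lambda>n. (\<phi> n, z n)) [0..<m]) i = h i))"

lemma unconditional_if_unconditionally_productive:
  assumes "unconditionally_f_omega_productive H T a"
  shows "unconditional a"
proof -
  have a: "range a \<subseteq> carrier H" "inj a"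
    and prod: "\<And>\<phi> z. bij \<phi> \<Longrightarrow> productive H T (\<lambda>n. a (\<phi> n) [^]\<^bsub>H\<^esub> (z n :: int))"
    using assms by (auto simp: unconditionally_f_omega_productive_def f_omega_productive_def)
  have "\<exists>h\<in>carrier H. \<forall>i. \<forall>\<^sub>F m in sequentially. finite_prod a (map (\<lambda>n. (\<phi> n, z n)) [0..<m]) i = h i"
    if "bij \<phi>" for \<phi> z
  proof -
    have "a n \<in> carrier H" for n using a by auto
    then have nth: "word_prod (map (\<lambda>n. (a (\<phi> n) [^]\<^bsub>H\<^esub> z n) i) [0..<m])
        = finite_prod a (map (\<lambda>n. (\<phi> n, z n)) [0..<m]) i" for i m
      by (simp add: int_pow_H finite_prod_def o_def)
    show ?thesis using productive_nth[OF prod[OF that], of z] unfolding nth .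
  qed
  with a show ?thesis unfolding unconditional_def by blast
qed

text \<open>Two consecutive partial products of the sequence in its given order eventually agree in
  coordinate \<open>i\<close>, so the factor between them is trivial there.\<close>

lemma unconditional_eventually_trivial:
  assumes "unconditional a"
  shows "\<forall>\<^sub>F n in sequentially. a n i = []"
proof -
  have a: "a n \<in> carrier H" for n using assms by (auto simp: unconditional_def)
  have "\<exists>h\<in>carrier H. \<forall>i. \<forall>\<^sub>F m in sequentially. finite_prod a (map (\<lambda>n. (id n, 1)) [0..<m]) i = h i"
    using assms unfolding unconditional_def by (elim conjE allE[of _ id] allE[of _ "\<lambda>_. 1"] impE) (rule bij_id)
  then obtain h where "\<forall>\<^sub>F m in sequentially. finite_prod a (map (\<lambda>n. (id n, 1)) [0..<m]) i = h i"
    by blast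
  moreover from this have "\<forall>\<^sub>F m in sequentially. finite_prod a (map (\<lambda>n. (id n, 1)) [0..<Suc m]) i = h i"
    by (subst eventually_sequentially_Suc)
  ultimately show ?thesis
  proof eventually_elim
    case (elim m)
    let ?P = "finite_prod a (map (\<lambda>n. (id n, 1)) [0..<m]) i"
    have red: "freely_reduced (a m i)" by (intro H_nth_reduced a)
    have "foldr push_letter ?P (a m i) = ?P"
      using elim a H_nth[OF a[of m], of i] red by (simp add: finite_prod_append) (simp add: finite_prod_def mult_Nil_right F.int_pow_1)
    then have "foldr push_letter (formal_inv ?P) (foldr push_letter ?P (a m i)) = foldr push_letter (formal_inv ?P) ?P"
      by simp
    then show "a m i = []" using red by (simp only: mult_formal_inv_left mult_inv_word)
  qed
qed

text \<open>
  A Baire category argument: if the number of blocks were unbounded on every tail, finite products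
  with more and more blocks could be concatenated into a rearrangement of the whole sequence whose
  limit is not in \<open>H\<close>.
\<close>

lemma unconditional_uniform_blocks:
  assumes a: "unconditional a"
  shows "\<exists>n0 K. \<forall>Q i. distinct (map fst Q) \<longrightarrow> fst ` set Q \<subseteq> {n0..} \<longrightarrow>
           mono_blocks K (map idx (finite_prod a Q i))"
proof (rule ccontr)
  assume "\<not> ?thesis"
  then have unbounded: "\<exists>Q i. distinct (map fst Q) \<and> fst ` set Q \<subseteq> {n0..} \<and>
      \<not> mono_blocks K (map idx (finite_prod a Q i))" for n0 K
    by blast
  have a_H: "range a \<subseteq> carrier H" using a by (simp add: unconditional_def)
  \<comment> \<open>A valid list uses each index below its length exactly once, so ever longer valid
    extensions enumerate a bijection of the natural numbers.\<close>
  define valid where "valid L \<longleftrightarrow> distinct (map fst L) \<and> fst ` set L = {..<length L}" for L :: "(nat \<times> int) list"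
  have step: "\<exists>L' i. valid L' \<and> (\<exists>M. M \<noteq> [] \<and> L' = L @ M) \<and> (\<forall>n\<ge>length L'. a n i = []) \<and>
      \<not> mono_blocks m (map idx (finite_prod a L' i))" if L: "valid L" for L m
  proof -
    obtain h where h: "h \<in> carrier H" "\<And>i. h i = finite_prod a L i"
      using finite_prod_in_H[OF a_H] by metis
    obtain k where k: "\<And>i. mono_blocks k (map idx (h i))" using H_blocks[OF h(1)] by blast
    obtain Q i where Q: "distinct (map fst Q)" "fst ` set Q \<subseteq> {length L..}"
      "\<not> mono_blocks (k + m) (map idx (finite_prod a Q i))"
      using unbounded by blast
    \<comment> \<open>Multiplying by the inverse of the product over \<open>L\<close>, which has at
      most \<open>k\<close> blocks, recovers the product over \<open>Q\<close>; so \<open>m\<close>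
      blocks for \<open>L @ Q\<close> would give \<open>k + m\<close> for \<open>Q\<close>.\<close>
    have LQ: "\<not> mono_blocks m (map idx (finite_prod a (L @ Q) i))"
    proof
      assume *: "mono_blocks m (map idx (finite_prod a (L @ Q) i))"
      have "mono_blocks k (map idx (formal_inv (finite_prod a L i)))"
        using blocks_rev[OF k[of i]] by (simp add: h(2) map_idx_formal_inv)
      from blocks_append[OF this *]
      have "mono_blocks (k + m) (map idx (foldr push_letter (formal_inv (finite_prod a L i)) (finite_prod a (L @ Q) i)))"
        unfolding map_append[symmetric] by (rule blocks_subseq[OF _ subseq_map[OF subseq_mult]])
      moreover have "foldr push_letter (formal_inv (finite_prod a L i)) (finite_prod a (L @ Q) i) = finite_prod a Q i"
        unfolding finite_prod_append
        by (rule mult_formal_inv_left) (simp add: finite_prod_def reduced_word_prod)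
      ultimately show False using Q(3) by simp
    qed
    obtain N0 where N0: "\<And>n. n \<ge> N0 \<Longrightarrow> a n i = []"
      using unconditional_eventually_trivial[OF a, of i] unfolding eventually_sequentially by blast
    obtain N1 where N1: "fst ` set (L @ Q) \<subseteq> {..<N1}"
      using finite_nat_iff_bounded[of "fst ` set (L @ Q)"] by auto
    \<comment> \<open>\<open>N0\<close> makes all later members trivial in coordinate
      \<open>i\<close>, \<open>N1\<close> exceeds every index used so far, and
      \<open>Suc (length L)\<close> forces proper growth.\<close>
    define N2 where "N2 = max (max N0 N1) (Suc (length L))"
    \<comment> \<open>The missing indices are filled in with exponent 0, which leaves the product
      unchanged.\<close>
    define R where "R = map (\<lambda>n. (n, 0::int)) (filter (\<lambda>n. n \<notin> fst ` set (L @ Q)) [0..<N2])"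
    define L' where "L' = L @ Q @ R"
    have R: "map fst R = filter (\<lambda>n. n \<notin> fst ` set (L @ Q)) [0..<N2]"
      by (simp add: R_def o_def)
    have "distinct (map fst (L @ Q))"
      using L Q by (force simp: valid_def)
    then have dist: "distinct (map fst L')"
      using R by (auto simp: L'_def)
    have "fst ` set R = {..<N2} - fst ` set (L @ Q)"
      by (force simp: R_def image_image)
    moreover have "fst ` set L' = fst ` set (L @ Q) \<union> fst ` set R"
      by (simp add: L'_def image_Un Un_assoc)
    moreover have "fst ` set (L @ Q) \<subseteq> {..<N2}"
      using N1 by (rule order_trans) (simp add: N2_def)
    ultimately have set: "fst ` set L' = {..<N2}" by blast
    have len: "length L' = N2"
      using distinct_card[OF dist] set by simp
    have L'_eq: "finite_prod a L' i = finite_prod a (L @ Q) i"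
    proof -
      have "finite_prod a R i = []" by (rule finite_prod_trivial) (auto simp: R_def)
      moreover have "freely_reduced (finite_prod a (L @ Q) i)"
        by (simp add: finite_prod_def reduced_word_prod)
      ultimately show ?thesis
        unfolding L'_def append_assoc[symmetric] by (subst finite_prod_append) (simp add: mult_Nil_right)
    qed
    have "Q @ R \<noteq> []"
    proof
      assume "Q @ R = []"
      then have "length L' = length L" by (simp add: L'_def)
      then show False using len by (simp add: N2_def)
    qed
    moreover have "valid L'" using dist set len by (simp add: valid_def)
    moreover have "\<forall>n\<ge>length L'. a n i = []" using N0 len by (simp add: N2_def)
    ultimately show ?thesis
      using LQ unfolding L'_eq[symmetric]
      by (intro exI[of _ L'] exI[of _ i] conjI exI[of _ "Q @ R"]) (simp_all add: L'_def)
  qed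
  define good where "good m s s' \<longleftrightarrow> (\<exists>M. M \<noteq> [] \<and> fst s' = fst s @ M) \<and>
      (\<forall>n\<ge>length (fst s'). a n (snd s') = []) \<and> \<not> mono_blocks m (map idx (finite_prod a (fst s') (snd s')))"
    for m and s s' :: "(nat \<times> int) list \<times> nat"
  have "\<exists>S. \<forall>m. valid (fst (S m)) \<and> good m (S m) (S (Suc m))"
  proof (rule dependent_nat_choice)
    show "\<exists>s :: (nat \<times> int) list \<times> nat. valid (fst s)" by (rule exI[of _ "([], 0)"]) (simp add: valid_def)
    show "\<exists>s'. valid (fst s') \<and> good m s s'" if s: "valid (fst s)" for s m
    proof -
      obtain L' i where "valid L'" "\<exists>M. M \<noteq> [] \<and> L' = fst s @ M" "\<forall>n\<ge>length L'. a n i = []"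
        "\<not> mono_blocks m (map idx (finite_prod a L' i))"
        using step[OF s] by blast
      then show ?thesis by (intro exI[of _ "(L', i)"]) (simp add: good_def)
    qed
  qed
  then obtain S where S: "\<And>m. valid (fst (S m))" "\<And>m. good m (S m) (S (Suc m))" by blast
  define L where "L m = fst (S m)" for m
  have L_valid: "valid (L m)" for m using S by (simp add: L_def)
  have L_step: "\<exists>M. M \<noteq> [] \<and> L (Suc m) = L m @ M" for m
    using S(2)[of m] by (simp add: good_def L_def)
  have L_long: "m \<le> length (L m)" for m
  proof (induction m)
    case (Suc m)
    obtain M where "M \<noteq> []" "L (Suc m) = L m @ M" using L_step by blast
    then show ?case using Suc by (cases M) auto
  qed simp
  have L_prefix: "\<exists>M. L n = L m @ M" if "m \<le> n" for m n
    using that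
  proof (induction n rule: dec_induct)
    case (step n)
    then show ?case using L_step[of n] by auto
  qed simp
  \<comment> \<open>\<open>L (Suc n)\<close> has an entry at position \<open>n\<close>, and all
    longer stages extend it, so \<open>p\<close> is the common limit of the lists.\<close>
  define p where "p n = L (Suc n) ! n" for n
  have p: "p n = L m ! n" if "n < length (L m)" for n m
  proof -
    have n: "n < length (L (Suc n))" using L_long[of "Suc n"] by simp
    show ?thesis
    proof (cases "m \<le> Suc n")
      case True
      then show ?thesis using L_prefix[OF True] that by (auto simp: p_def nth_append)
    next
      case False
      then show ?thesis using L_prefix[of "Suc n" m] n by (auto simp: p_def nth_append)
    qed
  qed
  have L_eq: "L m = map p [0..<length (L m)]" for m
    by (rule nth_equalityI) (simp_all add: p)
  have inj: "inj (fst \<circ> p)"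
  proof (rule injI)
    fix m n assume eq: "(fst \<circ> p) m = (fst \<circ> p) n"
    let ?k = "Suc (max m n)"
    have "m < length (L ?k)" "n < length (L ?k)" using L_long[of ?k] by linarith+
    moreover have "distinct (map fst (L ?k))" using L_valid by (simp add: valid_def)
    ultimately show "m = n"
      using eq p[of m ?k] p[of n ?k] by (simp add: distinct_conv_nth) (metis)
  qed
  have set_L: "fst ` p ` {..<length (L m)} = {..<length (L m)}" for m
  proof -
    have "set (L m) = p ` {..<length (L m)}" by (subst L_eq) (simp add: atLeast0LessThan)
    then show ?thesis using L_valid[of m] by (simp add: valid_def)
  qed
  have "n \<in> range (fst \<circ> p)" for n
  proof -
    have "n < length (L (Suc n))" using L_long[of "Suc n"] by simp
    then have "n \<in> fst ` p ` {..<length (L (Suc n))}" using set_L by simp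
    then show ?thesis by auto
  qed
  then have "bij (fst \<circ> p)" using inj by (auto simp: bij_def)
  then obtain h where h: "h \<in> carrier H"
    "\<And>i. \<forall>\<^sub>F m in sequentially. finite_prod a (map (\<lambda>n. ((fst \<circ> p) n, (snd \<circ> p) n)) [0..<m]) i = h i"
    using a unfolding unconditional_def by blast
  obtain k where k: "\<And>i. mono_blocks k (map idx (h i))" using H_blocks[OF h(1)] by blast
  \<comment> \<open>Stage \<open>Suc k\<close> was built to exceed \<open>k\<close> blocks, the
    bound for the limit \<open>h\<close>.\<close>
  define l where "l = length (L (Suc k))"
  define i where "i = snd (S (Suc k))"
  have triv: "a n i = []" if "n \<ge> l" for n
    using S(2)[of k] that by (simp add: good_def l_def L_def i_def)
  have not_blocks: "\<not> mono_blocks k (map idx (finite_prod a (L (Suc k)) i))"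
    using S(2)[of k] by (simp add: good_def L_def i_def)
  obtain m0 where m0: "\<And>m. m \<ge> m0 \<Longrightarrow> finite_prod a (map p [0..<m]) i = h i"
    using h(2)[of i] unfolding eventually_sequentially by auto
  have "[0..<l + m0] = [0..<l] @ [l..<l + m0]" by (rule upt_add_eq_append) simp
  moreover have "finite_prod a (map p [l..<l + m0]) i = []"
  proof (rule finite_prod_trivial)
    fix n z assume "(n, z) \<in> set (map p [l..<l + m0])"
    then obtain j where j: "l \<le> j" "p j = (n, z)" by auto
    \<comment> \<open>The first \<open>l\<close> positions already carry all indices below
      \<open>l\<close>.\<close>
    have "\<not> n < l"
    proof
      assume "n < l"
      then obtain j' where "j' < l" "fst (p j') = n"
        using set_L[of "Suc k"] unfolding l_def by (metis (no_types, lifting) imageE lessThan_iff)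
      then show False using injD[OF inj, of j j'] j by simp
    qed
    then show "a n i = [] \<or> z = 0" using triv by simp
  qed
  ultimately have "h i = finite_prod a (map p [0..<l]) i"
    using m0[of "l + m0"] by (simp add: finite_prod_append) (simp add: finite_prod_def mult_Nil_right reduced_word_prod)
  also have "map p [0..<l] = L (Suc k)" unfolding l_def by (rule L_eq[symmetric])
  finally show False using k[of i] not_blocks by simp
qed

section \<open>Conjugates of single-letter powers and the contradiction\<close>

text \<open>The power with exponent \<open>Suc K\<close> contains \<open>Suc K\<close> copies of the
  cyclically reduced core, so the bound \<open>K\<close> permits only one letter name in the core.
  \<open>H_filter\<close> then identifies that letter.\<close>

lemma conjugate_of_single_letter:
  assumes h: "h \<in> carrier H" and "h m \<noteq> []" and triv: "\<And>i. i < m \<Longrightarrow> h i = []" and "m \<le> j"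
    and mono_blocks: "\<And>z. mono_blocks K (map idx (h j [^]\<^bsub>F\<^esub> (z::int)))"
  shows "\<exists>c p y. h j = c @ replicate p y @ formal_inv c \<and> 0 < p \<and> idx y = m"
proof -
  have filter_j: "foldr push_letter (filter (\<lambda>l. idx l \<le> i) (h j)) [] = h i" if "i \<le> j" for i
    using H_filter[OF h that] .
  have "h j \<noteq> []" using filter_j[OF \<open>m \<le> j\<close>] \<open>h m \<noteq> []\<close> by auto
  moreover have red: "freely_reduced (h j)" using h by (rule H_nth_reduced)
  ultimately obtain c v where cv: "h j = c @ v @ formal_inv c" "v \<noteq> []" "hd v \<noteq> inv_letter (last v)"
    using cyclic_reduction by blast
  have v: "freely_reduced v" using red cv(1) by (simp add: reduced_append)
  have "h j [^]\<^bsub>F\<^esub> int (Suc K) = c @ concat (replicate (Suc K) v) @ formal_inv c"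
    unfolding int_pow_int cv(1) by (rule power_conjugate[OF red[unfolded cv(1)] cv(2,3)])
  then have "subseq (concat (replicate (Suc K) v)) (h j [^]\<^bsub>F\<^esub> int (Suc K))"
    by (simp only: list_emb_append2 subseq_rev_drop_many subseq_order.order_refl)
  then have "mono_blocks K (map idx (concat (replicate (Suc K) v)))"
    using mono_blocks subseq_map blocks_subseq by blast
  then have "mono_blocks K (concat (replicate (Suc K) (map idx v)))"
    by (simp only: map_concat map_replicate)
  then have idx_eq: "idx l = idx l'" if "l \<in> set v" "l' \<in> set v" for l l'
    using blocks_concat_replicate[of K "map idx v" "idx l" "idx l'"] that by simp
  have "fst ` set (h j) \<subseteq> N"
    using H_nth[OF h] by (simp add: carrier_free_group)
  then have N: "fst l \<in> N" if "l \<in> set v" for l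
    using that unfolding cv(1) set_append by blast
  have "fst l = fst l'" if "l \<in> set v" "l' \<in> set v" for l l'
    using idx_eq[OF that] ul_idx[OF N[OF that(1)]] ul_idx[OF N[OF that(2)]] by simp
  then obtain y where y: "v = replicate (length v) y"
    using reduced_single_letter[OF v] by blast
  define p where "p = length v"
  have p: "v = replicate p y" "0 < p" using y cv(2) by (simp_all add: p_def)
  have filter_v: "foldr push_letter (filter (\<lambda>l. idx l \<le> i) v) [] = [] \<longleftrightarrow> h i = []" if "i \<le> j" for i
    using filter_j[OF that] reduce_conjugate_trivial[of "filter (\<lambda>l. idx l \<le> i) v" "filter (\<lambda>l. idx l \<le> i) c"]
      reduce_conjugate_trivialD[of "filter (\<lambda>l. idx l \<le> i) c" "filter (\<lambda>l. idx l \<le> i) v"]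
    unfolding cv(1) filter_append filter_formal_inv by metis
  \<comment> \<open>The deletion removes all of the constant word \<open>v\<close> or nothing. Hence
    coordinate \<open>i\<close> is trivial exactly for \<open>i < idx y\<close>, and
    \<open>idx y\<close> is the first nontrivial coordinate.\<close>
  have "filter (\<lambda>l. idx l \<le> i) v = (if idx y \<le> i then v else [])" for i
    unfolding p(1) by (simp add: filter_replicate)
  then have iff: "h i = [] \<longleftrightarrow> i < idx y" if "i \<le> j" for i
    using filter_v[OF that] mult_Nil_right[OF v] cv(2) by (auto split: if_splits)
  have "idx y = m"
    using iff[of m] iff[of "idx y"] triv[of "idx y"] \<open>h m \<noteq> []\<close> \<open>m \<le> j\<close> by (metis leD le_trans linorder_neqE_nat nat_less_le)
  then show ?thesis using cv(1) p by blast
qed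

lemma not_unconditional: "\<not> unconditional a"
proof
  assume a: "unconditional a"
  then have a_H: "a n \<in> carrier H" for n by (auto simp: unconditional_def)
  have inj_a: "inj a" using a by (simp add: unconditional_def)
  obtain n0 K where K: "\<And>Q i. distinct (map fst Q) \<Longrightarrow> fst ` set Q \<subseteq> {n0..} \<Longrightarrow>
      mono_blocks K (map idx (finite_prod a Q i))"
    using unconditional_uniform_blocks[OF a] by metis
  \<comment> \<open>By injectivity at most one member is the identity, so some tail avoids
    it.\<close>
  obtain n1 where n1: "n1 \<ge> n0" "\<And>n. n \<ge> n1 \<Longrightarrow> a n \<noteq> (\<lambda>i. [])"
  proof (cases "\<exists>n. a n = (\<lambda>i. [])")
    case True
    then obtain n where n: "a n = (\<lambda>i. [])" by blast
    show ?thesis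
    proof (rule that[of "max n0 (Suc n)"])
      fix m assume "max n0 (Suc n) \<le> m"
      then show "a m \<noteq> (\<lambda>i. [])" using injD[OF inj_a, of m n] n by auto
    qed simp
  next
    case False
    then show ?thesis using that[of n0] by blast
  qed
  \<comment> \<open>The first nontrivial coordinate; it exists once
    \<open>n \<ge> n1\<close>.\<close>
  define \<mu> where "\<mu> n = (LEAST i. a n i \<noteq> [])" for n
  have \<mu>: "a n (\<mu> n) \<noteq> []" if n: "n \<ge> n1" for n
  proof -
    obtain i where "a n i \<noteq> []" using n1(2)[OF n] by (meson ext)
    then show ?thesis unfolding \<mu>_def by (rule LeastI)
  qed
  have \<mu>_least: "a n i = []" if "i < \<mu> n" for n i
    using not_less_Least[of i "\<lambda>i. a n i \<noteq> []"] that by (simp add: \<mu>_def)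
  have \<mu>_large: "\<forall>\<^sub>F n in sequentially. b < \<mu> n" for b
  proof -
    have "\<forall>\<^sub>F n in sequentially. \<forall>i\<in>{..b}. a n i = []"
      using unconditional_eventually_trivial[OF a] by (intro eventually_ball_finite) auto
    then have "\<forall>\<^sub>F n in sequentially. (\<forall>i\<in>{..b}. a n i = []) \<and> n \<ge> n1"
      using eventually_ge_at_top eventually_conj by blast
    then show ?thesis
    proof (rule eventually_mono)
      fix n assume "(\<forall>i\<in>{..b}. a n i = []) \<and> n \<ge> n1"
      then show "b < \<mu> n" using \<mu>[of n] by (metis atMost_iff not_le_imp_less)
    qed
  qed
  \<comment> \<open>Since \<open>\<mu>\<close> tends to infinity, it is strictly increasing along a
    subsequence.\<close>
  have "\<exists>s. \<forall>k. n1 \<le> s k \<and> (s k < s (Suc k) \<and> \<mu> (s k) < \<mu> (s (Suc k)))"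
  proof (rule dependent_nat_choice)
    fix x k :: nat assume "n1 \<le> x"
    have "\<forall>\<^sub>F n in sequentially. x < n \<and> \<mu> x < \<mu> n"
      using eventually_gt_at_top[of x] \<mu>_large[of "\<mu> x"] by (rule eventually_conj)
    then obtain n where "x < n \<and> \<mu> x < \<mu> n" using eventually_happens'[OF sequentially_bot] by blast
    then show "\<exists>n. n1 \<le> n \<and> (x < n \<and> \<mu> x < \<mu> n)" using \<open>n1 \<le> x\<close> by (intro exI[of _ n]) simp
  qed auto
  then obtain s where s: "\<And>k. n1 \<le> s k" "\<And>k. s k < s (Suc k)" "\<And>k. \<mu> (s k) < \<mu> (s (Suc k))"
    by blast
  have mono: "strict_mono (\<lambda>k. \<mu> (s k))"
    unfolding strict_mono_Suc_iff using s(3) by simp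
  \<comment> \<open>The first even length that exceeds the limit \<open>2 * K\<close> for zigzag
    lists.\<close>
  define L where "L = 2 * Suc K"
  \<comment> \<open>One coordinate for all chosen members: \<open>swap_adjacent\<close> keeps
    indices below \<open>L\<close>, so each of their first nontrivial coordinates is at most
    \<open>j\<close>.\<close>
  define j where "j = \<mu> (s L)"
  define ns where "ns = map (\<lambda>i. s (swap_adjacent i)) [0..<L]"
  have n1_ns: "n1 \<le> n" if "n \<in> set ns" for n
    using that s(1) by (auto simp: ns_def)
  have le_j: "\<mu> n \<le> j" if n: "n \<in> set ns" for n
  proof -
    obtain i where "i < L" "n = s (swap_adjacent i)" using n by (auto simp: ns_def)
    then show ?thesis
      using swap_less[of i "Suc K"] strict_mono_leD[OF mono, of "swap_adjacent i" L] by (simp add: j_def L_def)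
  qed
  have "\<exists>c p y. a n j = c @ replicate p y @ formal_inv c \<and> 0 < p \<and> idx y = \<mu> n" if n: "n \<in> set ns" for n
  proof (rule conjugate_of_single_letter[OF a_H \<mu>[OF n1_ns[OF n]] \<mu>_least le_j[OF n]])
    fix z :: int
    have "a n j [^]\<^bsub>F\<^esub> z \<in> carrier F" using a_H by simp
    then have "finite_prod a [(n, z)] j = a n j [^]\<^bsub>F\<^esub> z"
      by (simp add: finite_prod_def mult_Nil_right carrier_free_group)
    then show "mono_blocks K (map idx (a n j [^]\<^bsub>F\<^esub> z))"
      using K[of "[(n, z)]" j] n1_ns[OF n] n1(1) by simp
  qed
  then obtain c p y where cpy: "\<And>n. n \<in> set ns \<Longrightarrow> a n j = c n @ replicate (p n) (y n) @ formal_inv (c n)"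
    "\<And>n. n \<in> set ns \<Longrightarrow> 0 < p n" "\<And>n. n \<in> set ns \<Longrightarrow> idx (y n) = \<mu> n"
    by metis
  have \<mu>_ns: "map \<mu> ns = map (\<lambda>i. \<mu> (s (swap_adjacent i))) [0..<L]"
    by (simp add: ns_def)
  have "inj (\<lambda>i. \<mu> (s (swap_adjacent i)))"
    using inj_compose[OF strict_mono_imp_inj_on[OF mono] bij_is_inj[OF bij_swap]] by (simp add: o_def)
  from inj_on_subset[OF this subset_UNIV] have dist: "distinct (map \<mu> ns)"
    unfolding \<mu>_ns distinct_map by simp
  then have dist_ns: "distinct ns" by (simp add: distinct_map)
  have "successively (\<lambda>m n. fst (y m) \<noteq> fst (y n)) ns"
    unfolding successively_conv_nth
  proof (intro allI impI)
    fix i assume i: "Suc i < length ns"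
    then have "\<mu> (ns ! i) \<noteq> \<mu> (ns ! Suc i)"
      using dist by (simp add: distinct_conv_nth)
    then have "idx (y (ns ! i)) \<noteq> idx (y (ns ! Suc i))"
      using cpy(3) i by simp
    then show "fst (y (ns ! i)) \<noteq> fst (y (ns ! Suc i))" by (auto simp: idx_def)
  qed
  \<comment> \<open>The sum serves as the common bound \<open>C\<close> in
    \<open>large_powers\<close>.\<close>
  moreover have "length (c n) \<le> (\<Sum>n\<in>set ns. length (c n))" if "n \<in> set ns" for n
    using that by (intro member_le_sum) auto
  moreover have "ns \<noteq> []" by (simp add: ns_def L_def)
  ultimately obtain Q e t where Q: "map fst Q = ns" "(\<Sum>n\<in>set ns. length (c n)) < e" "subseq (map y (tl ns)) t"
    and prod: "word_prod (map (\<lambda>(n, z). a n j [^]\<^bsub>F\<^esub> (z::int)) Q) = c (hd ns) @ replicate e (y (hd ns)) @ t"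
    using large_powers[of ns "\<lambda>n. a n j" c p y "\<Sum>n\<in>set ns. length (c n)" N] cpy H_nth_reduced[OF a_H] by blast
  obtain e' where "e = Suc e'" using Q(2) by (cases e) auto
  \<comment> \<open>One letter of the leading block represents \<open>hd ns\<close>; the remaining
    letters are found in \<open>t\<close>.\<close>
  then have "subseq (y (hd ns) # map y (tl ns)) (c (hd ns) @ y (hd ns) # replicate e' (y (hd ns)) @ t)"
    using Q(3) by (intro list_emb_append2 list_emb_Cons2) auto
  moreover have "y (hd ns) # map y (tl ns) = map y ns"
    using \<open>ns \<noteq> []\<close> by (cases ns) auto
  ultimately have "subseq (map y ns) (finite_prod a Q j)"
    by (simp add: finite_prod_def prod \<open>e = Suc e'\<close>)
  moreover have "mono_blocks K (map idx (finite_prod a Q j))"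
  proof (rule K)
    show "distinct (map fst Q)" using Q(1) dist_ns by simp
    have "fst ` set Q = set ns" using Q(1) by (metis list.set_map)
    then show "fst ` set Q \<subseteq> {n0..}" using n1_ns n1(1) by force
  qed
  ultimately have "mono_blocks K (map idx (map y ns))"
    using subseq_map blocks_subseq by blast
  moreover have "map idx (map y ns) = map \<mu> ns" using cpy(3) by simp
  ultimately have "mono_blocks K (map (\<lambda>i. \<mu> (s (swap_adjacent i))) [0..<L])"
    by (simp only: \<mu>_ns)
  then have "length (map (\<lambda>i. \<mu> (s (swap_adjacent i))) [0..<L]) \<le> 2 * K"
    by (rule zigzag_blocks[OF zigzag_swap[OF mono]])
  then show False by (simp add: L_def)
qed

end

theorem theorem14p1:
  fixes N :: "'a set" and ul :: "nat \<Rightarrow> 'a"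
  assumes "bij_betw ul UNIV N"
  shows "metric_group (H_group N ul) (H_topology N ul) \<and> separable_space (H_topology N ul)
    \<and> linear_topology (H_group N ul) (H_topology N ul)
    \<and> (\<exists>b :: nat \<Rightarrow> nat \<Rightarrow> 'a letters.
          f_omega_productive (H_group N ul) (H_topology N ul) b \<and>
          (\<exists>\<phi> :: nat \<Rightarrow> nat. bij \<phi> \<and> \<not> productive (H_group N ul) (H_topology N ul) (\<lambda>n. b (\<phi> n))))
    \<and> TAP (H_group N ul) (H_topology N ul)"
proof -
  interpret alphabet N ul using assms by unfold_locales
  have "metric_group H T"
    unfolding metric_group_def using topological_group_H metrizable_space_T by blast
  moreover have "\<exists>b. f_omega_productive H T b \<and> (\<exists>\<phi>. bij \<phi> \<and> \<not> productive H T (\<lambda>n. b (\<phi> n)))"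
    using f_omega_productive_basis bij_swap not_productive_swap by blast
  moreover have "TAP H T"
    unfolding TAP_def using topological_group_H unconditional_if_unconditionally_productive not_unconditional by blast
  ultimately show ?thesis
    using separable_space_T linear_topology_H by blast
qed

end
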